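(* Let $M$ be a simply connected almost complex surface in the nearly Kähler $S^3\times S^3$, with immersion $\phi=(p,q)$, such that the holomorphic differential $\Lambda\,dz^2$ vanishes identically. Then there exists an immersion $\epsilon\colon M\to\mathbb R^3$ such that, in all isothermal coordinates $(u,v)$ on $M$ with $J\phi_u=\phi_v$, one has $\epsilon_u=\tilde\alpha$ and $\epsilon_v=\tilde\beta$, and this immersion has constant mean curvature equal to $-2/\sqrt3$. Moreover, the metric induced on $M$ by $\epsilon$ (from the Euclidean metric of $\mathbb R^3$) is half the metric induced on $M$ by $\phi$ from $g$.
   Context: $S^3$ is the group of unit quaternions, and $T_{(p,q)}(S^3\times S^3)$ is identified with $T_pS^3\times T_qS^3$. The almost complex structure $J$ on $S^3\times S^3$ is $J(U,V)=\frac{1}{\sqrt3}\bigl(2pq^{-1}V-U,\,-2qp^{-1}U+V\bigr)$ for $(U,V)\in T_{(p,q)}(S^3\times S^3)$ (quaternion multiplication). The metric is $g(X,Y)=\frac12\bigl(\langle X,Y\rangle+\langle JX,JY\rangle\bigr)$, where $\langle\cdot,\cdot\rangle$ is the standard product metric on $S^3\times S^3$ (product of two unit round metrics). The nearly Kähler $S^3\times S^3$ is $(S^3\times S^3,g,J)$. The almost product structure is $P(U,V)=(pq^{-1}V,\,qp^{-1}U)$. An almost complex surface is a smooth (immersed) surface $M$ whose tangent bundle is $J$-invariant; it carries the metric induced by $g$ and the complex structure induced by $J$. For isothermal coordinates $(u,v)$ on $M$ with $J\phi_u=\phi_v$, let $z=u+iv$, $\phi_z=\frac12(\phi_u-i\phi_v)$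 and $\Lambda=g(P\phi_z,\phi_z)$ (with $g$, $P$ extended complex (bi)linearly); then $\Lambda\,dz^2$ is a globally defined holomorphic quadratic differential on $M$. Let $\alpha=p^{-1}p_u$, $\beta=p^{-1}p_v$, which take values in the imaginary quaternions, identified with $\mathbb R^3$, and set $$\tilde\alpha=-\tfrac12\alpha+\tfrac{\sqrt3}{2}\beta,\qquad \tilde\beta=-\tfrac{\sqrt3}{2}\alpha-\tfrac12\beta .$$ The mean curvature $H$ of an immersion $\epsilon$ into $\mathbb R^3$ is half the trace of the second fundamental form with respect to the unit normal in the direction $\epsilon_u\times\epsilon_v$, so that in isothermal coordinates for $\epsilon$ one has $\epsilon_{uu}+\epsilon_{vv}=2H\,\epsilon_u\times\epsilon_v$. *)

theory Defs
  imports "HOL-Analysis.Analysis"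
begin

section \<open>Quaternions and the nearly Kaehler structure\<close>

text \<open>The pair \<open>(a, v)\<close> is the quaternion \<open>a + v\<^sub>1 i + v\<^sub>2 j + v\<^sub>3 k\<close>; thus \<open>snd\<close> identifies the
  imaginary quaternions with \<open>\<real>\<^sup>3\<close>, and the norm and inner product of the product type are the
  Euclidean ones of \<open>\<real>\<^sup>4\<close>.\<close>

type_synonym quat = "real \<times> (real^3)"

definition qmul :: "quat \<Rightarrow> quat \<Rightarrow> quat"  (infixl \<open>\<odot>\<close> 70) where
  "x \<odot> y = (fst x * fst y - snd x \<bullet> snd y,
            fst x *\<^sub>R snd y + fst y *\<^sub>R snd x + cross3 (snd x) (snd y))"

definition qinv :: "quat \<Rightarrow> quat" where
  "qinv x = (fst x / (norm x)\<^sup>2, - (snd x /\<^sub>R (norm x)\<^sup>2))"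

abbreviation S3 :: "quat set" where
  "S3 \<equiv> sphere 0 1"

text \<open>The tensors below take the base point \<open>r = (p, q)\<close> as first argument. Tangent vectors of
  \<open>S\<^sup>3 \<times> S\<^sup>3\<close> are vectors \<open>(U, V)\<close> of the ambient \<open>\<real>\<^sup>4 \<times> \<real>\<^sup>4\<close>, whose inner product restricts to the
  product of the two round metrics.\<close>

definition nk_J :: "quat \<times> quat \<Rightarrow> quat \<times> quat \<Rightarrow> quat \<times> quat" where
  "nk_J r X = (let p = fst r; q = snd r; U = fst X; V = snd X in
     (1 / sqrt 3) *\<^sub>R (2 *\<^sub>R (p \<odot> qinv q \<odot> V) - U, - (2 *\<^sub>R (q \<odot> qinv p \<odot> U)) + V))"

definition nk_g :: "quat \<times> quat \<Rightarrow> quat \<times> quat \<Rightarrow> quat \<times> quat \<Rightarrow> real" where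
  "nk_g r X Y = (1 / 2) * (X \<bullet> Y + nk_J r X \<bullet> nk_J r Y)"

definition nk_P :: "quat \<times> quat \<Rightarrow> quat \<times> quat \<Rightarrow> quat \<times> quat" where
  "nk_P r X = (let p = fst r; q = snd r; U = fst X; V = snd X in
     (p \<odot> qinv q \<odot> V, q \<odot> qinv p \<odot> U))"

text \<open>A complexified tangent vector \<open>X + iY\<close> is the pair \<open>(X, Y)\<close>; \<open>gC\<close> and \<open>PC\<close> are the complex
  (bi)linear extensions of \<open>nk_g\<close> and \<open>nk_P\<close>.\<close>

type_synonym ctangent = "(quat \<times> quat) \<times> (quat \<times> quat)"

definition gC :: "quat \<times> quat \<Rightarrow> ctangent \<Rightarrow> ctangent \<Rightarrow> complex" where
  "gC r Z W = Complex (nk_g r (fst Z) (fst W) - nk_g r (snd Z) (snd W))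
                      (nk_g r (fst Z) (snd W) + nk_g r (snd Z) (fst W))"

definition PC :: "quat \<times> quat \<Rightarrow> ctangent \<Rightarrow> ctangent" where
  "PC r Z = (nk_P r (fst Z), nk_P r (snd Z))"


section \<open>Smooth surfaces\<close>

text \<open>Coordinates \<open>(u, v)\<close> are written \<open>u + \<i>v\<close>, the complex numbers serving only as the real plane:
  all derivatives are real Frechet derivatives.\<close>

fun Ck_on :: "nat \<Rightarrow> (complex \<Rightarrow> 'b::real_normed_vector) \<Rightarrow> complex set \<Rightarrow> bool" where
  "Ck_on 0 f S \<longleftrightarrow> continuous_on S f"
| "Ck_on (Suc k) f S \<longleftrightarrow>
     (\<forall>z\<in>S. f differentiable (at z)) \<and> (\<forall>w. Ck_on k (\<lambda>z. frechet_derivative f (at z) w) S)"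

definition smooth_on :: "(complex \<Rightarrow> 'b::real_normed_vector) \<Rightarrow> complex set \<Rightarrow> bool" where
  "smooth_on f S \<longleftrightarrow> (\<forall>k. Ck_on k f S)"

text \<open>A chart is a pair \<open>(U, x)\<close> of a domain and a coordinate map.\<close>

type_synonym 'a chart = "'a set \<times> ('a \<Rightarrow> complex)"

abbreviation cdom :: "'a chart \<Rightarrow> 'a set" where
  "cdom c \<equiv> fst c"

abbreviation chart_inv :: "'a chart \<Rightarrow> complex \<Rightarrow> 'a" where
  "chart_inv c \<equiv> inv_into (fst c) (snd c)"

definition is_chart :: "'a::topological_space set \<Rightarrow> 'a chart \<Rightarrow> bool" where
  "is_chart M c \<longleftrightarrow> openin (top_of_set M) (cdom c) \<and> open (snd c ` cdom c) \<and>
     homeomorphism (cdom c) (snd c ` cdom c) (snd c) (chart_inv c)"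

definition compatible :: "'a chart \<Rightarrow> 'a chart \<Rightarrow> bool" where
  "compatible c d \<longleftrightarrow>
     smooth_on (snd d \<circ> chart_inv c) (snd c ` (cdom c \<inter> cdom d)) \<and>
     smooth_on (snd c \<circ> chart_inv d) (snd d ` (cdom c \<inter> cdom d))"

definition smooth_surface ::
  "'a::{t2_space,second_countable_topology} set \<Rightarrow> 'a chart set \<Rightarrow> bool" where
  "smooth_surface M A \<longleftrightarrow> (\<forall>c\<in>A. is_chart M c) \<and> (\<Union>c\<in>A. cdom c) = M \<and>
     (\<forall>c\<in>A. \<forall>d\<in>A. compatible c d)"

text \<open>All smooth local coordinates on the surface, i.e. the maximal atlas containing \<open>A\<close>.\<close>

definition coords :: "'a::topological_space set \<Rightarrow> 'a chart set \<Rightarrow> 'a chart set" where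
  "coords M A = {c. is_chart M c \<and> (\<forall>d\<in>A. compatible c d)}"

text \<open>\<open>diff c f m (a + \<i>b) = a f\<^sub>u + b f\<^sub>v\<close> at \<open>m\<close>, in the coordinates \<open>c = (u, v)\<close>.\<close>

definition diff :: "'a chart \<Rightarrow> ('a \<Rightarrow> 'b::real_normed_vector) \<Rightarrow> 'a \<Rightarrow> complex \<Rightarrow> 'b" where
  "diff c f m = frechet_derivative (f \<circ> chart_inv c) (at (snd c m))"

abbreviation du :: "'a chart \<Rightarrow> ('a \<Rightarrow> 'b::real_normed_vector) \<Rightarrow> 'a \<Rightarrow> 'b" where
  "du c f m \<equiv> diff c f m 1"

abbreviation dv :: "'a chart \<Rightarrow> ('a \<Rightarrow> 'b::real_normed_vector) \<Rightarrow> 'a \<Rightarrow> 'b" where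
  "dv c f m \<equiv> diff c f m \<i>"

definition smooth_map ::
  "'a::topological_space set \<Rightarrow> 'a chart set \<Rightarrow> ('a \<Rightarrow> 'b::real_normed_vector) \<Rightarrow> bool" where
  "smooth_map M A f \<longleftrightarrow> (\<forall>c\<in>coords M A. smooth_on (f \<circ> chart_inv c) (snd c ` cdom c))"

definition immersion ::
  "'a::topological_space set \<Rightarrow> 'a chart set \<Rightarrow> ('a \<Rightarrow> 'b::real_normed_vector) \<Rightarrow> bool" where
  "immersion M A f \<longleftrightarrow> smooth_map M A f \<and> (\<forall>c\<in>coords M A. \<forall>m\<in>cdom c. inj (diff c f m))"

text \<open>Mean curvature of an immersion into \<open>\<real>\<^sup>3\<close>: half the trace of the second fundamental form with
  respect to the first, in arbitrary coordinates and for the unit normal in the direction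
  \<open>\<epsilon>\<^sub>u \<times> \<epsilon>\<^sub>v\<close>.\<close>

definition unit_normal :: "'a chart \<Rightarrow> ('a \<Rightarrow> real^3) \<Rightarrow> 'a \<Rightarrow> real^3" where
  "unit_normal c e m =
     cross3 (du c e m) (dv c e m) /\<^sub>R norm (cross3 (du c e m) (dv c e m))"

definition first_form :: "'a chart \<Rightarrow> ('a \<Rightarrow> real^3) \<Rightarrow> 'a \<Rightarrow> real^2^2" where
  "first_form c e m =
     vector [vector [du c e m \<bullet> du c e m, du c e m \<bullet> dv c e m],
             vector [dv c e m \<bullet> du c e m, dv c e m \<bullet> dv c e m]]"

definition second_form :: "'a chart \<Rightarrow> ('a \<Rightarrow> real^3) \<Rightarrow> 'a \<Rightarrow> real^2^2" where
  "second_form c e m = (let n = unit_normal c e m in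
     vector [vector [du c (du c e) m \<bullet> n, du c (dv c e) m \<bullet> n],
             vector [dv c (du c e) m \<bullet> n, dv c (dv c e) m \<bullet> n]])"

definition mean_curvature :: "'a chart \<Rightarrow> ('a \<Rightarrow> real^3) \<Rightarrow> 'a \<Rightarrow> real" where
  "mean_curvature c e m =
     (1 / 2) * trace (matrix_inv (first_form c e m) ** second_form c e m)"


section \<open>Almost complex surfaces\<close>

definition almost_complex_surface ::
  "'a::{t2_space,second_countable_topology} set \<Rightarrow> 'a chart set \<Rightarrow> ('a \<Rightarrow> quat \<times> quat) \<Rightarrow> bool" where
  "almost_complex_surface M A \<phi> \<longleftrightarrow>
     smooth_surface M A \<and> \<phi> ` M \<subseteq> S3 \<times> S3 \<and> immersion M A \<phi> \<and>
     (\<forall>c\<in>coords M A. \<forall>m\<in>cdom c. nk_J (\<phi> m) ` range (diff c \<phi> m) \<subseteq> range (diff c \<phi> m))"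

definition induced_metric ::
  "'a chart \<Rightarrow> ('a \<Rightarrow> quat \<times> quat) \<Rightarrow> 'a \<Rightarrow> complex \<Rightarrow> complex \<Rightarrow> real" where
  "induced_metric c \<phi> m w w' = nk_g (\<phi> m) (diff c \<phi> m w) (diff c \<phi> m w')"

text \<open>Isothermal coordinates with \<open>J \<phi>\<^sub>u = \<phi>\<^sub>v\<close>.\<close>

definition isothermal :: "'a chart \<Rightarrow> ('a \<Rightarrow> quat \<times> quat) \<Rightarrow> bool" where
  "isothermal c \<phi> \<longleftrightarrow> (\<forall>m\<in>cdom c.
     induced_metric c \<phi> m 1 1 = induced_metric c \<phi> m \<i> \<i> \<and>
     induced_metric c \<phi> m 1 \<i> = 0 \<and>
     nk_J (\<phi> m) (du c \<phi> m) = dv c \<phi> m)"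

text \<open>Coordinates compatible with the orientation of the complex structure induced by \<open>J\<close>: since
  \<open>J \<phi>\<^sub>u\<close> is orthogonal to \<open>\<phi>\<^sub>u\<close>, the condition says that \<open>\<phi>\<^sub>v = a \<phi>\<^sub>u + b J \<phi>\<^sub>u\<close> with \<open>b > 0\<close>.
  Isothermal coordinates with \<open>J \<phi>\<^sub>u = \<phi>\<^sub>v\<close> are of this kind.\<close>

definition positively_oriented :: "'a chart \<Rightarrow> ('a \<Rightarrow> quat \<times> quat) \<Rightarrow> bool" where
  "positively_oriented c \<phi> \<longleftrightarrow>
     (\<forall>m\<in>cdom c. nk_g (\<phi> m) (nk_J (\<phi> m) (du c \<phi> m)) (dv c \<phi> m) > 0)"

text \<open>\<open>\<phi>\<^sub>z = (\<phi>\<^sub>u - \<i>\<phi>\<^sub>v) / 2\<close> and \<open>\<Lambda> = g(P\<phi>\<^sub>z, \<phi>\<^sub>z)\<close>, in isothermal coordinates.\<close>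

definition dz :: "'a chart \<Rightarrow> ('a \<Rightarrow> quat \<times> quat) \<Rightarrow> 'a \<Rightarrow> ctangent" where
  "dz c \<phi> m = ((1 / 2) *\<^sub>R du c \<phi> m, - ((1 / 2) *\<^sub>R dv c \<phi> m))"

definition Lambda :: "'a chart \<Rightarrow> ('a \<Rightarrow> quat \<times> quat) \<Rightarrow> 'a \<Rightarrow> complex" where
  "Lambda c \<phi> m = gC (\<phi> m) (PC (\<phi> m) (dz c \<phi> m)) (dz c \<phi> m)"

text \<open>The global quadratic differential \<open>\<Lambda> dz\<^sup>2\<close>, evaluated on the tangent vector \<open>X\<close> whose
  components in the (arbitrary) coordinates \<open>c\<close> are \<open>w = a + \<i>b\<close>: it is \<open>g(PZ, Z)\<close> for the
  part \<open>Z = (X - \<i>JX) / 2\<close> of type \<open>(1,0)\<close> of \<open>X\<close>. For \<open>X = \<phi>\<^sub>u\<close> in isothermal coordinates, \<open>Z = \<phi>\<^sub>z\<close>;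
  see \<open>Lambda_dz2_isothermal\<close> below.\<close>

definition Lambda_dz2 :: "'a chart \<Rightarrow> ('a \<Rightarrow> quat \<times> quat) \<Rightarrow> 'a \<Rightarrow> complex \<Rightarrow> complex" where
  "Lambda_dz2 c \<phi> m w =
     (let X = diff c \<phi> m w; Z = ((1 / 2) *\<^sub>R X, - ((1 / 2) *\<^sub>R nk_J (\<phi> m) X))
      in gC (\<phi> m) (PC (\<phi> m) Z) Z)"

text \<open>\<open>\<alpha> = p\<^sup>-\<^sup>1 p\<^sub>u\<close> and \<open>\<beta> = p\<^sup>-\<^sup>1 p\<^sub>v\<close> for \<open>\<phi> = (p, q)\<close>, as vectors of \<open>\<real>\<^sup>3\<close>.\<close>

definition alpha :: "'a chart \<Rightarrow> ('a \<Rightarrow> quat \<times> quat) \<Rightarrow> 'a \<Rightarrow> real^3" where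
  "alpha c \<phi> m = snd (qinv (fst (\<phi> m)) \<odot> du c (\<lambda>x. fst (\<phi> x)) m)"

definition beta :: "'a chart \<Rightarrow> ('a \<Rightarrow> quat \<times> quat) \<Rightarrow> 'a \<Rightarrow> real^3" where
  "beta c \<phi> m = snd (qinv (fst (\<phi> m)) \<odot> dv c (\<lambda>x. fst (\<phi> x)) m)"

definition alpha_tilde :: "'a chart \<Rightarrow> ('a \<Rightarrow> quat \<times> quat) \<Rightarrow> 'a \<Rightarrow> real^3" where
  "alpha_tilde c \<phi> m = (- 1 / 2) *\<^sub>R alpha c \<phi> m + (sqrt 3 / 2) *\<^sub>R beta c \<phi> m"

definition beta_tilde :: "'a chart \<Rightarrow> ('a \<Rightarrow> quat \<times> quat) \<Rightarrow> 'a \<Rightarrow> real^3" where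
  "beta_tilde c \<phi> m = (- sqrt 3 / 2) *\<^sub>R alpha c \<phi> m - (1 / 2) *\<^sub>R beta c \<phi> m"


section \<open>The quadratic differential in isothermal coordinates\<close>

lemma qmul_add_right: "x \<odot> (y + z) = x \<odot> y + x \<odot> z"
  by (simp add: qmul_def inner_add_right cross_add_right algebra_simps)

lemma qmul_scaleR_right: "x \<odot> (a *\<^sub>R y) = a *\<^sub>R (x \<odot> y)"
  by (simp add: qmul_def cross_mult_right algebra_simps)

lemma qmul_assoc: "x \<odot> y \<odot> z = x \<odot> (y \<odot> z)"
  by (simp add: qmul_def cross3_def inner_vec_def sum_3 vec_eq_iff forall_3 algebra_simps)

lemma qmul_one: "(1, 0) \<odot> x = x"
  by (simp add: qmul_def)

lemma qinv_qmul: "x \<in> S3 \<Longrightarrow> qinv x \<odot> x = (1, 0)"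
  by (auto simp: qmul_def qinv_def norm_prod_def dot_square_norm power2_eq_square cross_mult_left)

lemma S3_cancel:
  assumes "p \<in> S3" "q \<in> S3"
  shows "p \<odot> qinv q \<odot> (q \<odot> qinv p \<odot> U) = U"
proof -
  have pp: "p \<odot> qinv p = (1, 0)"
    using assms(1)
    by (auto simp: qmul_def qinv_def norm_prod_def dot_square_norm power2_eq_square cross_mult_right)
  have "p \<odot> qinv q \<odot> (q \<odot> qinv p \<odot> U) = p \<odot> ((qinv q \<odot> q) \<odot> (qinv p \<odot> U))"
    by (simp only: qmul_assoc)
  also have "\<dots> = p \<odot> qinv p \<odot> U"
    using assms by (simp add: qinv_qmul qmul_one qmul_assoc)
  finally show ?thesis by (simp add: pp qmul_one)
qed

lemma linear_nk_J: "linear (nk_J r)"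
  by (rule linearI)
    (simp_all add: nk_J_def Let_def prod_eq_iff qmul_add_right qmul_scaleR_right algebra_simps)

lemma linear_nk_P: "linear (nk_P r)"
  by (rule linearI) (simp_all add: nk_P_def Let_def prod_eq_iff qmul_add_right qmul_scaleR_right)

lemma nk_J_nk_J:
  assumes "r \<in> S3 \<times> S3"
  shows "nk_J r (nk_J r X) = - X"
proof -
  obtain p q U V where [simp]: "r = (p, q)" "X = (U, V)"
    by (cases r, cases X) auto
  define a where "a = p \<odot> qinv q"
  define b where "b = q \<odot> qinv p"
  have ab: "a \<odot> (b \<odot> Y) = Y" "b \<odot> (a \<odot> Y) = Y" for Y
    using assms S3_cancel[of p q Y] S3_cancel[of q p Y] by (auto simp: a_def b_def)
  have J: "nk_J r (Y, Z) = (1 / sqrt 3) *\<^sub>R (2 *\<^sub>R (a \<odot> Z) - Y, - (2 *\<^sub>R (b \<odot> Y)) + Z)" for Y Z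
    by (simp add: nk_J_def a_def b_def)
  have third: "(4 / 3 :: real) = 1 / 3 + 1" by simp
  have qd: "x \<odot> (y - z) = x \<odot> y - x \<odot> z" for x y z
    using qmul_add_right[of x "y - z" z] by simp
  have "nk_J r (nk_J r X) = (1 / sqrt 3) *\<^sub>R nk_J r (2 *\<^sub>R (a \<odot> V) - U, - (2 *\<^sub>R (b \<odot> U)) + V)"
    by (simp only: \<open>X = _\<close> J linear_scale[OF linear_nk_J])
  also have "\<dots> = (1 / sqrt 3) *\<^sub>R (1 / sqrt 3) *\<^sub>R (- 3 *\<^sub>R U, - 3 *\<^sub>R V)"
    unfolding J
    by (simp add: qd qmul_scaleR_right ab algebra_simps)
       (metis add.commute scale_one scale_left_distrib third)
  also have "\<dots> = - X"
    by simp
  finally show ?thesis .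
qed

lemma Lambda_dz2_isothermal:
  assumes M: "almost_complex_surface M A \<phi>" and c: "c \<in> coords M A" "isothermal c \<phi>"
    and m: "m \<in> cdom c"
  shows "Lambda_dz2 c \<phi> m w = Lambda c \<phi> m * w\<^sup>2"
proof -
  define r where "r = \<phi> m"
  define X where "X = du c \<phi> m"
  define Y where "Y = dv c \<phi> m"
  have "m \<in> M"
    using c(1) m openin_imp_subset by (fastforce simp: coords_def is_chart_def)
  then have r: "r \<in> S3 \<times> S3"
    using M by (auto simp: almost_complex_surface_def r_def)
  have JX: "nk_J r X = Y"
    using c(2) m by (auto simp: isothermal_def r_def X_def Y_def)
  then have JY: "nk_J r Y = - X"
    using nk_J_nk_J[OF r] by metis
  have "Ck_on (Suc 0) (\<phi> \<circ> chart_inv c) (snd c ` cdom c)"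
    using M c(1) by (simp only: almost_complex_surface_def immersion_def smooth_map_def smooth_on_def)
  then have "linear (diff c \<phi> m)"
    using m by (auto simp: diff_def linear_frechet_derivative)
  then have "diff c \<phi> m (Re w *\<^sub>R 1 + Im w *\<^sub>R \<i>) = Re w *\<^sub>R X + Im w *\<^sub>R Y"
    unfolding X_def Y_def by (simp add: linear_add linear_scale)
  moreover have "Re w *\<^sub>R 1 + Im w *\<^sub>R \<i> = w"
    by (simp add: complex_eq_iff)
  ultimately have w: "diff c \<phi> m w = Re w *\<^sub>R X + Im w *\<^sub>R Y"
    by simp
  have Jw: "nk_J r (Re w *\<^sub>R X + Im w *\<^sub>R Y) = Re w *\<^sub>R Y - Im w *\<^sub>R X"
    using linear_nk_J[of r] by (simp add: linear_add linear_scale JX JY)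
  have g_add: "nk_g r (x + y) z = nk_g r x z + nk_g r y z" 
    "nk_g r z (x + y) = nk_g r z x + nk_g r z y"
    "nk_g r (x - y) z = nk_g r x z - nk_g r y z" 
    "nk_g r z (x - y) = nk_g r z x - nk_g r z y" for x y z
    using linear_nk_J[of r]
    by (simp_all add: nk_g_def linear_add linear_diff inner_add_left inner_add_right
        inner_diff_left inner_diff_right field_simps)
  have g_scale: "nk_g r (s *\<^sub>R x) z = s * nk_g r x z" "nk_g r z (s *\<^sub>R x) = s * nk_g r z x"
    "nk_g r (- x) z = - nk_g r x z" "nk_g r z (- x) = - nk_g r z x" for s x z
    using linear_nk_J[of r]
    by (simp_all add: nk_g_def linear_scale linear_neg inner_scaleR_left algebra_simps)
  have P: "nk_P r (x + y) = nk_P r x + nk_P r y" "nk_P r (x - y) = nk_P r x - nk_P r y"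
    "nk_P r (s *\<^sub>R x) = s *\<^sub>R nk_P r x" "nk_P r (- x) = - nk_P r x" for s x y
    using linear_nk_P[of r] by (simp_all add: linear_add linear_diff linear_scale linear_neg)
  show ?thesis
    unfolding Lambda_dz2_def Lambda_def dz_def gC_def PC_def Let_def w
    unfolding r_def[symmetric] X_def[symmetric] Y_def[symmetric] Jw
    by (simp add: complex_eq_iff P g_add g_scale power2_eq_square field_simps)
qed

end

theory Submission
  imports Defs
begin

text \<open>
  Write \<open>\<phi> = (p, q)\<close> and consider on \<open>M\<close> the \<open>\<real>\<^sup>3\<close>-valued 1-form
  \<open>\<omega> = q\<^sup>-\<^sup>1 dq - p\<^sup>-\<^sup>1 dp\<close>. The formula for \<open>J\<close> says that in left-invariant frames \<open>J\<close> sends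
  \<open>(a, c)\<close> to \<open>(2c - a, c - 2a) / \<surd>3\<close>; hence, in isothermal coordinates with \<open>J\<phi>\<^sub>u = \<phi>\<^sub>v\<close>, the
  components of \<open>\<omega>\<close> are exactly \<open>\<alpha>\<close>-tilde and \<open>\<beta>\<close>-tilde. Since \<open>\<omega>\<close> is defined without any choice
  of coordinates, it can be studied in an arbitrary chart.

  Closedness. The Maurer-Cartan equation (lemma \<open>maurer_cartan\<close>, which rests on the symmetry of
  second derivatives) expresses \<open>d(p\<^sup>-\<^sup>1 dp)\<close> and \<open>d(q\<^sup>-\<^sup>1 dq)\<close> by the cross products
  \<open>\<alpha> \<times> \<beta>\<close> and \<open>\<gamma> \<times> \<delta>\<close> of the components of the two forms. Invariance of the tangent plane
  under \<open>J\<close> makes these cross products equal (\<open>cross_frame\<close>), so \<open>d\<omega> = 0\<close>. By the Poincare lemma on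
  discs (\<open>closed_form_primitive\<close>) \<open>\<omega>\<close> has local primitives; two of them differ by locally constant
  functions, and on a simply connected space such local functions glue to a global \<open>\<epsilon>\<close> with
  \<open>d\<epsilon> = \<omega>\<close> (\<open>glue_simply_connected\<close>).

  Metric. In the frame, vanishing of the quadratic differential means
  \<open>\<bar>a\<bar>\<^sup>2 + \<bar>c\<bar>\<^sup>2 = 4 \<langle>a, c\<rangle>\<close> for every tangent vector \<open>(a, c)\<close>, and this turns \<open>\<bar>c - a\<bar>\<^sup>2\<close> into half of
  \<open>g\<close> (\<open>norm_body_diff\<close>). Polarization gives the full metric, and in particular \<open>\<epsilon>\<close> is an immersion
  which is conformal.

  Mean curvature. Let \<open>\<kappa> = \<omega> \<circ> J = - (q\<^sup>-\<^sup>1 dq + p\<^sup>-\<^sup>1 dp) / \<surd>3\<close>. It takes values in the tangent plane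
  of \<open>\<epsilon>\<close>, and the same two Maurer-Cartan equations give \<open>d\<kappa> = (4 / \<surd>3) \<epsilon>\<^sub>u \<times> \<epsilon>\<^sub>v\<close>. For a conformal
  immersion \<open>\<kappa>\<close> is minus the Hodge dual of \<open>d\<epsilon>\<close>, so \<open>d\<kappa>\<close> is minus the Laplacian of \<open>\<epsilon>\<close>, that is,
  \<open>- 2H \<epsilon>\<^sub>u \<times> \<epsilon>\<^sub>v\<close>, whence \<open>H = - 2 / \<surd>3\<close>. Lemma \<open>mean_curvature_algebra\<close> is this comparison
  in arbitrary oriented coordinates.
\<close>

section \<open>Gluing locally given functions over a simply connected space\<close>

lemma eventually_at_within_comp:
  assumes "continuous_on T \<sigma>" "\<sigma> \<in> T \<rightarrow> S" "s \<in> T"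
    and "\<forall>\<^sub>F x in at (\<sigma> s) within S. P x" "P (\<sigma> s)"
  shows "\<forall>\<^sub>F t in at s within T. P (\<sigma> t)"
proof -
  obtain N where N: "open N" "\<sigma> s \<in> N" "\<And>x. x \<in> N \<Longrightarrow> x \<in> S \<Longrightarrow> P x"
    using assms(4,5) unfolding eventually_at_topological by metis
  obtain O' where O': "open O'" "s \<in> O'" "\<forall>t\<in>T. t \<in> O' \<longrightarrow> \<sigma> t \<in> N"
    using assms(1) N(1,2) assms(3) unfolding continuous_on_topological by metis
  then show ?thesis
    unfolding eventually_at_topological using N(3) assms(2) by blast
qed

text \<open>A Cech cocycle of constants, given by functions: the \<open>F i\<close> are local primitives of one and the same
  closed form, of which only the differences \<open>F i - F j\<close>, being locally constant, are visible. The
  aim is a global function that differs from every \<open>F i\<close> by a constant.\<close>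

locale local_functions =
  fixes M :: "'a::topological_space set" and I :: "'i set"
    and W :: "'i \<Rightarrow> 'a set" and F :: "'i \<Rightarrow> 'a \<Rightarrow> 'b::ab_group_add"
  assumes W_open: "i \<in> I \<Longrightarrow> openin (top_of_set M) (W i)"
    and W_cover: "(\<Union>i\<in>I. W i) = M"
    and compat: "i \<in> I \<Longrightarrow> j \<in> I \<Longrightarrow> x \<in> W i \<Longrightarrow> x \<in> W j \<Longrightarrow>
      \<forall>\<^sub>F y in at x within M. F i y - F j y = F i x - F j x"
begin

text \<open>\<open>h\<close> continues a local primitive along the map \<open>\<Gamma>\<close> into \<open>M\<close>. Quantifying over all indices \<open>i\<close>
  instead of asking for one of them makes lifts over overlapping sets directly comparable; by
  \<open>compat\<close> the two requirements agree.\<close>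

definition lift :: "'s::topological_space set \<Rightarrow> ('s \<Rightarrow> 'a) \<Rightarrow> ('s \<Rightarrow> 'b) \<Rightarrow> bool" where
  "lift S \<Gamma> h \<longleftrightarrow> (\<forall>s\<in>S. \<forall>i\<in>I. \<Gamma> s \<in> W i \<longrightarrow>
     (\<forall>\<^sub>F t in at s within S. h t - F i (\<Gamma> t) = h s - F i (\<Gamma> s)))"

lemma lift_comp:
  assumes "lift S \<Gamma> h" "continuous_on T \<sigma>" "\<sigma> \<in> T \<rightarrow> S"
  shows "lift T (\<Gamma> \<circ> \<sigma>) (h \<circ> \<sigma>)"
  unfolding lift_def comp_def
proof (intro ballI impI)
  fix s i assume s: "s \<in> T" "i \<in> I" "\<Gamma> (\<sigma> s) \<in> W i"
  then have "\<forall>\<^sub>F t in at (\<sigma> s) within S. h t - F i (\<Gamma> t) = h (\<sigma> s) - F i (\<Gamma> (\<sigma> s))"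
    using assms(1,3) unfolding lift_def by blast
  then show "\<forall>\<^sub>F t in at s within T. h (\<sigma> t) - F i (\<Gamma> (\<sigma> t)) = h (\<sigma> s) - F i (\<Gamma> (\<sigma> s))"
    by (rule eventually_at_within_comp[OF assms(2,3) s(1)]) simp
qed

lemma lift_subset: "lift S \<Gamma> h \<Longrightarrow> T \<subseteq> S \<Longrightarrow> lift T \<Gamma> h"
  using lift_comp[of S \<Gamma> h T id] by (auto simp: comp_def id_def)

lemma lift_cong:
  assumes "lift S \<Gamma> h" "\<And>s. s \<in> S \<Longrightarrow> \<Gamma>' s = \<Gamma> s" "\<And>s. s \<in> S \<Longrightarrow> h' s = h s"
  shows "lift S \<Gamma>' h'"
  unfolding lift_def
proof (intro ballI impI)
  fix s i assume s: "s \<in> S" "i \<in> I" "\<Gamma>' s \<in> W i"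
  then have "\<forall>\<^sub>F t in at s within S. h t - F i (\<Gamma> t) = h s - F i (\<Gamma> s)"
    using assms unfolding lift_def by auto
  moreover have "\<forall>\<^sub>F t in at s within S. t \<in> S"
    unfolding eventually_at_topological by (metis open_UNIV UNIV_I)
  ultimately show "\<forall>\<^sub>F t in at s within S. h' t - F i (\<Gamma>' t) = h' s - F i (\<Gamma>' s)"
    by eventually_elim (use s assms in auto)
qed

lemma lift_add_const: "lift S \<Gamma> h \<Longrightarrow> lift S \<Gamma> (\<lambda>s. h s + c)"
  unfolding lift_def
  by (simp add: diff_conv_add_uminus add.commute[of _ c] add.assoc del: add_uminus_conv_diff)

lemma lift_unique:
  assumes h: "lift S \<Gamma> h" and k: "lift S \<Gamma> k" and S: "connected S" "\<Gamma> \<in> S \<rightarrow> M"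
    and st: "s \<in> S" "t \<in> S"
  shows "h s - k s = h t - k t"
proof (rule connected_local_const[OF S(1) st], intro ballI)
  fix a assume a: "a \<in> S"
  then obtain i where i: "i \<in> I" "\<Gamma> a \<in> W i"
    using S(2) W_cover by blast
  have "\<forall>\<^sub>F t in at a within S. h t - F i (\<Gamma> t) = h a - F i (\<Gamma> a)"
       "\<forall>\<^sub>F t in at a within S. k t - F i (\<Gamma> t) = k a - F i (\<Gamma> a)"
    using h k a i unfolding lift_def by auto
  then show "\<forall>\<^sub>F b in at a within S. h a - k a = h b - k b"
    by eventually_elim (metis diff_diff_eq2 diff_add_cancel add_diff_cancel_right)
qed

lemma lift_local:
  assumes "continuous_on S \<Gamma>" "\<Gamma> \<in> S \<rightarrow> M" "s \<in> S"
  obtains N h where "open N" "s \<in> N" "lift (S \<inter> N) \<Gamma> h"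
proof -
  obtain i where i: "i \<in> I" "\<Gamma> s \<in> W i"
    using assms(2,3) W_cover by blast
  obtain O' where O': "open O'" "W i = M \<inter> O'"
    using W_open[OF i(1)] by (auto simp: openin_open)
  obtain N where N: "open N" "s \<in> N" "\<forall>t\<in>S. t \<in> N \<longrightarrow> \<Gamma> t \<in> O'"
    using assms(1,3) O' i(2) unfolding continuous_on_topological by (metis Int_iff)
  have "lift (S \<inter> N) \<Gamma> (\<lambda>t. F i (\<Gamma> t))"
    unfolding lift_def
  proof (intro ballI impI)
    fix t j assume t: "t \<in> S \<inter> N" "j \<in> I" "\<Gamma> t \<in> W j"
    then have "\<Gamma> t \<in> W i"
      using N(3) O'(2) assms(2) by auto
    then have "\<forall>\<^sub>F y in at (\<Gamma> t) within M. F i y - F j y = F i (\<Gamma> t) - F j (\<Gamma> t)"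
      using compat t i by blast
    then show "\<forall>\<^sub>F y in at t within (S \<inter> N). F i (\<Gamma> y) - F j (\<Gamma> y) = F i (\<Gamma> t) - F j (\<Gamma> t)"
      by (rule eventually_at_within_comp[rotated 3])
        (use assms t in \<open>auto intro: continuous_on_subset\<close>)
  qed
  with N show ?thesis using that by blast
qed

text \<open>Two lifts differ by a constant on the connected overlap; after a shift of the second one by this
  constant they form a single function.\<close>

lemma lift_Un:
  assumes h: "lift A \<Gamma> h" and k: "lift B \<Gamma> k"
    and cl: "closed A" "closed B" and conn: "connected (A \<inter> B)" and \<Gamma>: "\<Gamma> \<in> A \<rightarrow> M"
  obtains l where "lift (A \<union> B) \<Gamma> l"
proof -
  have "\<exists>c. \<forall>x\<in>A \<inter> B. h x = k x + c"
  proof (cases "A \<inter> B = {}")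
    case False
    then obtain x where x: "x \<in> A \<inter> B" by blast
    have "h y - k y = h x - k x" if "y \<in> A \<inter> B" for y
      using lift_unique[OF lift_subset[OF h] lift_subset[OF k] conn _ that x] \<Gamma> by auto
    then have "\<forall>y\<in>A \<inter> B. h y = k y + (h x - k x)"
      by (metis add.commute diff_add_cancel)
    then show ?thesis by blast
  qed auto
  then obtain c where c: "\<And>x. x \<in> A \<Longrightarrow> x \<in> B \<Longrightarrow> h x = k x + c" by blast
  define l where "l s = (if s \<in> A then h s else k s + c)" for s
  have A: "lift A \<Gamma> l"
    using h by (rule lift_cong) (auto simp: l_def)
  have B: "lift B \<Gamma> l"
    using lift_add_const[OF k, of c] by (rule lift_cong) (auto simp: l_def c)
  have far: "at s within C = bot" if "closed C" "s \<notin> C" for C :: "'c set" and s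
    using that by (simp add: at_within_eq_bot_iff)
  have "lift (A \<union> B) \<Gamma> l"
    unfolding lift_def at_within_union eventually_sup
  proof (intro ballI impI conjI)
    fix s i assume s: "s \<in> A \<union> B" "i \<in> I" "\<Gamma> s \<in> W i"
    show "\<forall>\<^sub>F t in at s within A. l t - F i (\<Gamma> t) = l s - F i (\<Gamma> s)"
      using A s far[OF cl(1)] by (cases "s \<in> A") (auto simp: lift_def)
    show "\<forall>\<^sub>F t in at s within B. l t - F i (\<Gamma> t) = l s - F i (\<Gamma> s)"
      using B s far[OF cl(2)] by (cases "s \<in> B") (auto simp: lift_def)
  qed
  then show ?thesis using that by blast
qed

text \<open>Bisection in each of the two directions: lifts over small rectangles exist by continuity of \<open>\<Gamma>\<close>,
  and neighbouring rectangles meet in an edge, which is connected. A thin strip around a fixed height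
  \<open>y0\<close> is treated first; its thickness may shrink each time two pieces are joined.\<close>

lemma lift_rectangle:
  fixes \<Gamma> :: "real \<times> real \<Rightarrow> 'a"
  assumes cont: "continuous_on ({a..b} \<times> {c..d}) \<Gamma>" and im: "\<Gamma> \<in> {a..b} \<times> {c..d} \<rightarrow> M"
    and "a \<le> b" "c \<le> d"
  obtains h where "lift ({a..b} \<times> {c..d}) \<Gamma> h"
proof -
  define Q where "Q y z \<longleftrightarrow> (c \<le> y \<and> z \<le> d \<longrightarrow> (\<exists>h. lift ({a..b} \<times> {y..z}) \<Gamma> h))" for y z
  have "Q c d"
  proof (rule Bolzano[OF \<open>c \<le> d\<close>, of Q])
    fix x y z assume *: "Q x y" "Q y z" "x \<le> y" "y \<le> z"
    show "Q x z"
      unfolding Q_def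
    proof
      assume xz: "c \<le> x \<and> z \<le> d"
      then obtain h k where "lift ({a..b} \<times> {x..y}) \<Gamma> h" "lift ({a..b} \<times> {y..z}) \<Gamma> k"
        using * unfolding Q_def by auto
      moreover have "({a..b} \<times> {x..y}) \<inter> ({a..b} \<times> {y..z}) = {a..b} \<times> {y}"
        "({a..b} \<times> {x..y}) \<union> ({a..b} \<times> {y..z}) = {a..b} \<times> {x..z}"
        using * by auto
      moreover have "\<Gamma> \<in> {a..b} \<times> {x..y} \<rightarrow> M"
        using im xz * by fastforce
      moreover have "closed ({a..b} \<times> {x..y})" "closed ({a..b} \<times> {y..z})" "connected ({a..b} \<times> {y})"
        by (auto intro!: closed_Times connected_Times)
      ultimately show "\<exists>h. lift ({a..b} \<times> {x..z}) \<Gamma> h"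
        using lift_Un[of "{a..b} \<times> {x..y}" \<Gamma> h "{a..b} \<times> {y..z}" k] by metis
    qed
  next
    fix y0 assume y0: "c \<le> y0" "y0 \<le> d"
    define T where "T \<delta> = {y0 - \<delta>..y0 + \<delta>} \<inter> {c..d}" for \<delta>
    define R where "R x y \<longleftrightarrow> (a \<le> x \<and> y \<le> b \<longrightarrow> (\<exists>\<delta>>0. \<exists>h. lift ({x..y} \<times> T \<delta>) \<Gamma> h))" for x y
    have T: "T \<delta> \<subseteq> T \<delta>'" if "\<delta> \<le> \<delta>'" for \<delta> \<delta>'
      using that by (auto simp: T_def)
    have T_cl: "closed (T \<delta>)" "connected (T \<delta>)" "T \<delta> \<subseteq> {c..d}" for \<delta>
      unfolding T_def by (auto intro: closed_Int convex_connected convex_Int)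
    have "R a b"
    proof (rule Bolzano[OF \<open>a \<le> b\<close>, of R])
      fix x y z assume *: "R x y" "R y z" "x \<le> y" "y \<le> z"
      show "R x z"
        unfolding R_def
      proof
        assume xz: "a \<le> x \<and> z \<le> b"
        then obtain \<delta> \<delta>' h k where \<delta>: "\<delta> > 0" "lift ({x..y} \<times> T \<delta>) \<Gamma> h"
          "\<delta>' > 0" "lift ({y..z} \<times> T \<delta>') \<Gamma> k"
          using * unfolding R_def by auto
        define \<eta> where "\<eta> = min \<delta> \<delta>'"
        have \<eta>: "\<eta> > 0" "T \<eta> \<subseteq> T \<delta>" "T \<eta> \<subseteq> T \<delta>'"
          using \<delta> T by (auto simp: \<eta>_def)
        have "lift ({x..y} \<times> T \<eta>) \<Gamma> h" "lift ({y..z} \<times> T \<eta>) \<Gamma> k"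
          using \<delta> \<eta> by (auto elim!: lift_subset)
        moreover have "({x..y} \<times> T \<eta>) \<inter> ({y..z} \<times> T \<eta>) = {y} \<times> T \<eta>"
          "({x..y} \<times> T \<eta>) \<union> ({y..z} \<times> T \<eta>) = {x..z} \<times> T \<eta>"
          using * by auto
        moreover have "\<Gamma> \<in> {x..y} \<times> T \<eta> \<rightarrow> M"
          using im xz * T_cl(3)[of \<eta>] by fastforce
        moreover have "closed ({x..y} \<times> T \<eta>)" "closed ({y..z} \<times> T \<eta>)" "connected ({y} \<times> T \<eta>)"
          using T_cl[of \<eta>] by (auto intro!: closed_Times connected_Times)
        ultimately have "\<exists>l. lift ({x..z} \<times> T \<eta>) \<Gamma> l"
          using lift_Un[of "{x..y} \<times> T \<eta>" \<Gamma> h "{y..z} \<times> T \<eta>" k] by metis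
        then show "\<exists>\<delta>>0. \<exists>h. lift ({x..z} \<times> T \<delta>) \<Gamma> h"
          using \<eta> by blast
      qed
    next
      fix x0 assume x0: "a \<le> x0" "x0 \<le> b"
      obtain N h where N: "open N" "(x0, y0) \<in> N" "lift (({a..b} \<times> {c..d}) \<inter> N) \<Gamma> h"
        using lift_local[OF cont im, of "(x0, y0)"] x0 y0 by auto
      obtain U V where UV: "open U" "open V" "x0 \<in> U" "y0 \<in> V" "U \<times> V \<subseteq> N"
        using open_prod_elim[OF N(1,2)] by (metis mem_Sigma_iff)
      obtain e where e: "e > 0" "cball x0 e \<subseteq> U"
        using UV open_contains_cball by blast
      obtain e' where e': "e' > 0" "cball y0 e' \<subseteq> V"
        using UV open_contains_cball by blast
      have "R x y" if "x \<le> x0 \<and> x0 \<le> y \<and> y - x < e" for x y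
        unfolding R_def
      proof
        assume xy: "a \<le> x \<and> y \<le> b"
        have "{x..y} \<subseteq> cball x0 e"
          using that by (auto simp: dist_real_def)
        moreover have "T e' \<subseteq> cball y0 e'"
          by (auto simp: dist_real_def T_def)
        ultimately have "{x..y} \<times> T e' \<subseteq> N"
          using UV(5) e e' by blast
        moreover have "{x..y} \<times> T e' \<subseteq> {a..b} \<times> {c..d}"
          using xy T_cl(3) by auto
        ultimately have "lift ({x..y} \<times> T e') \<Gamma> h"
          using N(3) by (blast intro: lift_subset)
        then show "\<exists>\<delta>>0. \<exists>h. lift ({x..y} \<times> T \<delta>) \<Gamma> h"
          using e' by blast
      qed
      then show "\<exists>e>0. \<forall>x y. x \<le> x0 \<and> x0 \<le> y \<and> y - x < e \<longrightarrow> R x y"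
        using e by blast
    qed
    then obtain \<delta> h where \<delta>: "\<delta> > 0" "lift ({a..b} \<times> T \<delta>) \<Gamma> h"
      unfolding R_def by auto
    have "Q x y" if "x \<le> y0 \<and> y0 \<le> y \<and> y - x < \<delta>" for x y
      unfolding Q_def
    proof
      assume "c \<le> x \<and> y \<le> d"
      then have "{a..b} \<times> {x..y} \<subseteq> {a..b} \<times> T \<delta>"
        using that by (auto simp: T_def)
      then show "\<exists>h. lift ({a..b} \<times> {x..y}) \<Gamma> h"
        using \<delta>(2) lift_subset by blast
    qed
    then show "\<exists>\<delta>>0. \<forall>x y. x \<le> y0 \<and> y0 \<le> y \<and> y - x < \<delta> \<longrightarrow> Q x y"
      using \<delta> by blast
  qed
  then show ?thesis
    using that by (auto simp: Q_def)
qed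

text \<open>The integral of the closed form along the path \<open>g\<close>.\<close>

definition increment :: "(real \<Rightarrow> 'a) \<Rightarrow> 'b \<Rightarrow> bool" where
  "increment g \<delta> \<longleftrightarrow> (\<exists>h. lift {0..1} g h \<and> \<delta> = h 1 - h 0)"

lemma increment_exists:
  assumes "path g" "path_image g \<subseteq> M"
  obtains \<delta> where "increment g \<delta>"
proof -
  have "continuous_on ({0..1::real} \<times> {0..1::real}) (g \<circ> fst)"
    using assms(1) unfolding path_def
    by (intro continuous_on_compose[of _ fst g] continuous_intros) auto
  moreover have "g \<circ> fst \<in> {0..1::real} \<times> {0..1::real} \<rightarrow> M"
    using assms(2) by (auto simp: path_image_def)
  ultimately obtain h where "lift ({0..1::real} \<times> {0..1::real}) (g \<circ> fst) h"
    using lift_rectangle[of 0 1 0 1 "g \<circ> fst"] by auto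
  from lift_comp[OF this, of "{0..1}" "\<lambda>t. (t, 0)"]
  have "lift {0..1} g (h \<circ> (\<lambda>t. (t, 0)))"
    by (simp add: comp_def continuous_on_Pair Pi_def)
  then show ?thesis using that by (auto simp: increment_def)
qed

lemma increment_unique:
  assumes "increment g \<delta>" "increment g \<delta>'" "path_image g \<subseteq> M"
  shows "\<delta> = \<delta>'"
proof -
  obtain h k where hk: "lift {0..1} g h" "lift {0..1} g k" "\<delta> = h 1 - h 0" "\<delta>' = k 1 - k 0"
    using assms by (auto simp: increment_def)
  then have "h 1 - k 1 = h 0 - k 0"
    using assms(3) by (intro lift_unique[OF hk(1,2)]) (auto simp: path_image_def)
  then show ?thesis
    unfolding hk(3,4) by (metis add_diff_cancel_left' diff_add_cancel diff_add_eq)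
qed

lemma increment_reversepath: "increment g \<delta> \<Longrightarrow> increment (reversepath g) (- \<delta>)"
  using lift_comp[of "{0..1}" g _ "{0..1}" "\<lambda>t. 1 - t"]
  unfolding increment_def reversepath_def
  by (fastforce simp: comp_def intro!: continuous_intros)

lemma increment_join:
  assumes "increment g \<delta>" "increment g' \<delta>'" "pathfinish g = pathstart g'"
    and im: "path_image g \<subseteq> M" "path_image g' \<subseteq> M"
  shows "increment (g +++ g') (\<delta> + \<delta>')"
proof -
  obtain h k where hk: "lift {0..1} g h" "lift {0..1} g' k" "\<delta> = h 1 - h 0" "\<delta>' = k 1 - k 0"
    using assms by (auto simp: increment_def)
  have "lift {0..1/2} (g \<circ> (\<lambda>t. 2 * t)) (h \<circ> (\<lambda>t. 2 * t))"
    by (rule lift_comp[OF hk(1)]) (auto intro!: continuous_intros)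
  then have h: "lift {0..1/2} (g +++ g') (h \<circ> (\<lambda>t. 2 * t))"
    by (rule lift_cong) (auto simp: joinpaths_def)
  have "lift {1/2..1} (g' \<circ> (\<lambda>t. 2 * t - 1)) (k \<circ> (\<lambda>t. 2 * t - 1))"
    by (rule lift_comp[OF hk(2)]) (auto intro!: continuous_intros)
  then have k: "lift {1/2..1} (g +++ g') (k \<circ> (\<lambda>t. 2 * t - 1))"
    by (rule lift_cong)
      (use assms(3) in \<open>auto simp: joinpaths_def pathfinish_def pathstart_def mult.commute[of _ 2]\<close>)
  have "path_image (g +++ g') \<subseteq> M"
    using im path_image_join_subset by blast
  then have M: "(g +++ g') \<in> {0..1} \<rightarrow> M"
    by (auto simp: path_image_def)
  have half: "{0..1/2} \<inter> {1/2..1} = {1/2::real}" "{0..1/2} \<union> {1/2..1} = {0..1::real}"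
    by auto
  have sub: "{0..1/2} \<subseteq> {0..1::real}" "{1/2..1} \<subseteq> {0..1::real}"
    by auto
  obtain l where l: "lift {0..1} (g +++ g') l"
  proof (rule lift_Un[OF h k, unfolded half])
    show "(g +++ g') \<in> {0..1/2} \<rightarrow> M"
      using M by auto
  qed (auto intro: that)
  have "h (2 * (1/2)) - l (1/2) = h (2 * 0) - l 0"
    using lift_unique[OF h lift_subset[OF l sub(1)], of "1/2" 0] M by (auto simp: comp_def Pi_def)
  moreover have "k (2 * 1 - 1) - l 1 = k (2 * (1/2) - 1) - l (1/2)"
    using lift_unique[OF k lift_subset[OF l sub(2)], of 1 "1/2"] M by (auto simp: comp_def Pi_def)
  ultimately have "h 1 - h 0 = l (1/2) - l 0" "k 1 - k 0 = l 1 - l (1/2)"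
    by (simp_all add: algebra_simps)
  then have "l 1 - l 0 = \<delta> + \<delta>'"
    unfolding hk(3,4) by simp
  with l show ?thesis
    unfolding increment_def by metis
qed

text \<open>Lift a free homotopy from the loop to a constant one. The two edges of the square that are
  traced by the start and the end of the loops run along the same path, so they contribute the same
  increment, and the edge of the constant loop contributes nothing; hence the edge of the given loop
  has increment zero.\<close>

lemma increment_loop:
  assumes "simply_connected M" "path g" "path_image g \<subseteq> M" "pathfinish g = pathstart g"
    and "increment g \<delta>"
  shows "\<delta> = 0"
proof -
  define x where "x = pathstart g"
  have "x \<in> M"
    using assms by (auto simp: x_def)
  then have "homotopic_loops M g (\<lambda>_. x)"
    using assms(1-4) unfolding simply_connected_def
    by (elim allE[where x = g] allE[where x = "\<lambda>_. x"])
      (auto simp: path_def path_image_def pathstart_def pathfinish_def)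
  then obtain \<Gamma> where \<Gamma>: "continuous_on ({0..1::real} \<times> {0..1::real}) \<Gamma>"
      "\<Gamma> \<in> ({0..1} \<times> {0..1}) \<rightarrow> M"
      "\<And>t. t \<in> {0..1} \<Longrightarrow> \<Gamma> (0, t) = g t" "\<And>t. t \<in> {0..1} \<Longrightarrow> \<Gamma> (1, t) = x"
      "\<And>t. t \<in> {0..1} \<Longrightarrow> \<Gamma> (t, 1) = \<Gamma> (t, 0)"
    unfolding homotopic_loops pathfinish_def pathstart_def comp_def by blast
  obtain h where h: "lift ({0..1} \<times> {0..1}) \<Gamma> h"
    using lift_rectangle[OF \<Gamma>(1,2)] by auto
  have edge: "lift {0..1} (\<lambda>t. \<Gamma> (\<sigma> t)) (\<lambda>t. h (\<sigma> t))"
    if "continuous_on {0..1} \<sigma>" "\<sigma> \<in> {0..1::real} \<rightarrow> {0..1} \<times> {0..1}" for \<sigma>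
    using lift_comp[OF h that] by (simp add: comp_def)
  have "lift {0..1} g (\<lambda>t. h (0, t))"
    by (rule lift_cong[OF edge[of "\<lambda>t. (0, t)"]]) (auto simp: \<Gamma> intro!: continuous_intros)
  then have "\<delta> = h (0, 1) - h (0, 0)"
    using increment_unique[OF assms(5) _ assms(3)] unfolding increment_def by auto
  moreover have "h (1, 1) - 0 = h (1, 0) - 0"
  proof (rule lift_unique[where h = "\<lambda>t. h (1, t)" and k = "\<lambda>t. 0"])
    show "lift {0..1} (\<lambda>t. x) (\<lambda>t. h (1, t))"
      by (rule lift_cong[OF edge[of "\<lambda>t. (1, t)"]]) (auto simp: \<Gamma> intro!: continuous_intros)
    show "lift {0..1::real} (\<lambda>t. x) (\<lambda>t. 0)"
      by (simp add: lift_def)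
  qed (use \<open>x \<in> M\<close> in auto)
  moreover have "h (1, 1) - h (1, 0) = h (0, 1) - h (0, 0)"
  proof (rule lift_unique[where h = "\<lambda>t. h (t, 1)" and k = "\<lambda>t. h (t, 0)"])
    show "lift {0..1} (\<lambda>t. \<Gamma> (t, 0)) (\<lambda>t. h (t, 1))"
      by (rule lift_cong[OF edge[of "\<lambda>t. (t, 1)"]]) (auto simp: \<Gamma> intro!: continuous_intros)
    show "lift {0..1} (\<lambda>t. \<Gamma> (t, 0)) (\<lambda>t. h (t, 0))"
      by (rule edge) (auto intro!: continuous_intros)
  qed (use \<Gamma>(2) in auto)
  ultimately show ?thesis by simp
qed

text \<open>The integral of the closed form from a base point to \<open>x\<close> does not depend on the path, by
  \<open>increment_loop\<close>; it serves as \<open>\<epsilon> x\<close>. Path-connectedness of \<open>W i\<close> allows a path to be prolonged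
  inside \<open>W i\<close>, where the form is integrated by \<open>F i\<close> itself.\<close>

theorem glue_simply_connected:
  assumes sc: "simply_connected M" and W: "\<And>i. i \<in> I \<Longrightarrow> path_connected (W i)"
  obtains \<epsilon> where "\<And>i x y. i \<in> I \<Longrightarrow> x \<in> W i \<Longrightarrow> y \<in> W i \<Longrightarrow> \<epsilon> y - F i y = \<epsilon> x - F i x"
proof (cases "M = {}")
  case True
  then show ?thesis using that[of undefined] W_cover by blast
next
  case False
  then obtain m where m: "m \<in> M" by blast
  define path_to where "path_to x g \<longleftrightarrow> path g \<and> path_image g \<subseteq> M \<and> pathstart g = m \<and> pathfinish g = x" for x g
  have path_to: "\<exists>g. path_to x g" if "x \<in> M" for x
  proof -
    \<comment> \<open>A free homotopy between two constant loops contains a path between the points, so that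
      simple connectedness includes path-connectedness.\<close>
    have "homotopic_loops M (\<lambda>_. m) (\<lambda>_. x)"
      using sc that m unfolding simply_connected_def
      by (elim allE[where x = "\<lambda>_. m"] allE[where x = "\<lambda>_. x"])
        (auto simp: path_def path_image_def pathstart_def pathfinish_def)
    then obtain \<Gamma> where \<Gamma>: "continuous_on ({0..1::real} \<times> {0..1::real}) \<Gamma>"
      "\<Gamma> \<in> ({0..1} \<times> {0..1}) \<rightarrow> M" "\<Gamma> (0, 0) = m" "\<Gamma> (1, 0) = x"
      unfolding homotopic_loops by fastforce
    have "continuous_on {0..1} (\<Gamma> \<circ> (\<lambda>t. (t, 0)))"
      by (intro continuous_on_compose continuous_intros continuous_on_subset[OF \<Gamma>(1)]) auto
    then have "path_to x (\<Gamma> \<circ> (\<lambda>t. (t, 0)))"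
      using \<Gamma> by (auto simp: path_to_def path_def path_image_def pathstart_def pathfinish_def)
    then show ?thesis by blast
  qed
  have indep: "\<delta> = \<delta>'" if g: "path_to x g" "path_to x g'" "increment g \<delta>" "increment g' \<delta>'" for x g g' \<delta> \<delta>'
  proof -
    have "increment (g +++ reversepath g') (\<delta> + - \<delta>')"
      using g by (intro increment_join increment_reversepath) (auto simp: path_to_def)
    moreover have "path_image (g +++ reversepath g') \<subseteq> M"
      using g path_image_join_subset[of g "reversepath g'"] by (auto simp: path_to_def)
    ultimately have "\<delta> + - \<delta>' = 0"
      using g by (intro increment_loop[OF sc, of "g +++ reversepath g'"]) (auto simp: path_to_def)
    then show ?thesis by simp
  qed
  have "\<forall>x. \<exists>\<delta>. x \<in> M \<longrightarrow> (\<exists>g. path_to x g \<and> increment g \<delta>)"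
    using path_to increment_exists unfolding path_to_def by metis
  then obtain \<epsilon> where \<epsilon>: "\<And>x. x \<in> M \<Longrightarrow> \<exists>g. path_to x g \<and> increment g (\<epsilon> x)"
    by metis
  have "\<epsilon> y - F i y = \<epsilon> x - F i x" if i: "i \<in> I" and xy: "x \<in> W i" "y \<in> W i" for i x y
  proof -
    have sub: "W i \<subseteq> M"
      using W_cover i by blast
    obtain g where g: "path_to x g" "increment g (\<epsilon> x)"
      using \<epsilon> sub xy by blast
    obtain g' where g': "path_to y g'" "increment g' (\<epsilon> y)"
      using \<epsilon> sub xy by blast
    obtain \<gamma> where \<gamma>: "path \<gamma>" "path_image \<gamma> \<subseteq> W i" "pathstart \<gamma> = x" "pathfinish \<gamma> = y"
      using W[OF i] xy unfolding path_connected_def by blast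
    have "lift {0..1} \<gamma> (\<lambda>t. F i (\<gamma> t))"
      unfolding lift_def
    proof (intro ballI impI)
      fix s j assume s: "s \<in> {0..1}" "j \<in> I" "\<gamma> s \<in> W j"
      have im: "\<gamma> \<in> {0..1} \<rightarrow> W i"
        using \<gamma>(2) by (auto simp: path_image_def)
      have "\<forall>\<^sub>F y in at (\<gamma> s) within M. F i y - F j y = F i (\<gamma> s) - F j (\<gamma> s)"
        using compat[OF i s(2)] s im by blast
      then show "\<forall>\<^sub>F y in at s within {0..1}. F i (\<gamma> y) - F j (\<gamma> y) = F i (\<gamma> s) - F j (\<gamma> s)"
        by (rule eventually_at_within_comp[rotated 3]) (use \<gamma>(1) im sub s in \<open>auto simp: path_def\<close>)
    qed
    then have "increment \<gamma> (F i y - F i x)"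
      using \<gamma>(3,4) by (auto simp: increment_def pathstart_def pathfinish_def)
    then have "increment (g +++ \<gamma>) (\<epsilon> x + (F i y - F i x))"
      using g \<gamma> sub by (intro increment_join) (auto simp: path_to_def)
    moreover have "path_to y (g +++ \<gamma>)"
      using g \<gamma> sub path_image_join_subset[of g \<gamma>] by (auto simp: path_to_def)
    ultimately have "\<epsilon> x + (F i y - F i x) = \<epsilon> y"
      using indep g' by blast
    then show ?thesis
      by (simp add: algebra_simps)
  qed
  then show ?thesis using that by blast
qed

end

section \<open>Smooth functions on plane domains\<close>

lemma Ck_on_differentiable: "Ck_on (Suc k) f S \<Longrightarrow> z \<in> S \<Longrightarrow>
    (f has_derivative frechet_derivative f (at z)) (at z)"
  by (simp add: frechet_derivative_works)

lemma Ck_on_continuous: "Ck_on k f S \<Longrightarrow> continuous_on S f"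
  by (cases k)
    (auto intro!: continuous_at_imp_continuous_on differentiable_imp_continuous_within)

lemma Ck_on_mono_Suc: "Ck_on (Suc k) f S \<Longrightarrow> Ck_on k f S"
proof (induction k arbitrary: f)
  case 0
  then show ?case using Ck_on_continuous[OF 0] by simp
next
  case (Suc k)
  then show ?case by simp
qed

lemma has_derivative_cong_open:
  assumes "open S" "z \<in> S" "\<And>x. x \<in> S \<Longrightarrow> f x = g x" "(f has_derivative D) (at z)"
  shows "(g has_derivative D) (at z)"
  by (rule has_derivative_transform_within_open[OF assms(4,1,2)]) (use assms(3) in auto)

lemma frechet_derivative_eqI: "(f has_derivative D) (at z) \<Longrightarrow> frechet_derivative f (at z) = D"
  by (rule frechet_derivative_at[symmetric])

text \<open>All congruence and closure properties refer to open sets, on which the Frechet derivative is a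
  local notion.\<close>

lemma Ck_on_cong:
  assumes "open S" "\<And>z. z \<in> S \<Longrightarrow> f z = g z" "Ck_on k f S"
  shows "Ck_on k g S"
  using assms(2,3)
proof (induction k arbitrary: f g)
  case 0
  then show ?case by (simp cong: continuous_on_cong)
next
  case (Suc k)
  have D: "(g has_derivative frechet_derivative f (at z)) (at z)" if "z \<in> S" for z
    by (rule has_derivative_cong_open[OF assms(1) that Suc.prems(1) Ck_on_differentiable[OF Suc.prems(2) that]])
  have "Ck_on k (\<lambda>z. frechet_derivative g (at z) w) S" for w
  proof (rule Suc.IH)
    show "Ck_on k (\<lambda>z. frechet_derivative f (at z) w) S"
      using Suc.prems(2) by simp
  qed (simp add: frechet_derivative_eqI[OF D])
  moreover have "\<forall>z\<in>S. g differentiable (at z)"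
    using D by (auto simp: differentiable_def)
  ultimately show ?case by simp
qed

lemma Ck_on_SucI:
  assumes S: "open S" and f: "\<And>z. z \<in> S \<Longrightarrow> (f has_derivative f' z) (at z)"
    and f': "\<And>w. Ck_on k (\<lambda>z. f' z w) S"
  shows "Ck_on (Suc k) f S"
proof -
  have "Ck_on k (\<lambda>z. frechet_derivative f (at z) w) S" for w
    by (rule Ck_on_cong[OF S _ f']) (simp add: frechet_derivative_eqI[OF f])
  then show ?thesis
    using f by (auto simp: differentiable_def)
qed

lemma Ck_on_add:
  assumes S: "open S"
  shows "Ck_on k f S \<Longrightarrow> Ck_on k g S \<Longrightarrow> Ck_on k (\<lambda>z. f z + g z) S"
proof (induction k arbitrary: f g)
  case 0
  then show ?case by (simp add: continuous_on_add)
next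
  case (Suc k)
  show ?case
    by (rule Ck_on_SucI[OF S has_derivative_add[OF Ck_on_differentiable Ck_on_differentiable]])
      (use Suc in auto)
qed

lemma Ck_on_bounded_linear:
  assumes S: "open S" and L: "bounded_linear L"
  shows "Ck_on k f S \<Longrightarrow> Ck_on k (\<lambda>z. L (f z)) S"
proof (induction k arbitrary: f)
  case 0
  then show ?case using L by (simp add: bounded_linear.continuous_on)
next
  case (Suc k)
  show ?case
    by (rule Ck_on_SucI[OF S bounded_linear.has_derivative[OF L Ck_on_differentiable]])
      (use Suc in auto)
qed

text \<open>The product rule produces the factors themselves beside their derivatives, so the induction
  hypothesis is applied to them one order lower.\<close>

lemma Ck_on_bounded_bilinear:
  assumes S: "open S" and B: "bounded_bilinear B"
  shows "Ck_on k f S \<Longrightarrow> Ck_on k g S \<Longrightarrow> Ck_on k (\<lambda>z. B (f z) (g z)) S"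
proof (induction k arbitrary: f g)
  case 0
  then show ?case using B by (simp add: bounded_bilinear.continuous_on)
next
  case (Suc k)
  have "Ck_on k f S" "Ck_on k g S"
    using Suc.prems by (auto intro: Ck_on_mono_Suc)
  then have "Ck_on k (\<lambda>z. B (f z) (frechet_derivative g (at z) w) + B (frechet_derivative f (at z) w) (g z)) S" for w
    using Suc.prems by (intro Ck_on_add[OF S] Suc.IH) auto
  then show ?case
    by (intro Ck_on_SucI[OF S bounded_bilinear.FDERIV[OF B Ck_on_differentiable Ck_on_differentiable]])
      (use Suc.prems in auto)
qed

lemma smooth_on_derivative:
  "smooth_on f S \<Longrightarrow> smooth_on (\<lambda>z. frechet_derivative f (at z) w) S"
  unfolding smooth_on_def by (metis Ck_on.simps(2))

lemma smooth_on_differentiable: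
  "smooth_on f S \<Longrightarrow> z \<in> S \<Longrightarrow> (f has_derivative frechet_derivative f (at z)) (at z)"
  unfolding smooth_on_def using Ck_on_differentiable by blast

lemma smooth_on_bounded_linear:
  "open S \<Longrightarrow> bounded_linear L \<Longrightarrow> smooth_on f S \<Longrightarrow> smooth_on (\<lambda>z. L (f z)) S"
  unfolding smooth_on_def using Ck_on_bounded_linear by blast

lemma smooth_on_bounded_bilinear:
  "open S \<Longrightarrow> bounded_bilinear B \<Longrightarrow> smooth_on f S \<Longrightarrow> smooth_on g S \<Longrightarrow>
    smooth_on (\<lambda>z. B (f z) (g z)) S"
  unfolding smooth_on_def using Ck_on_bounded_bilinear by blast

lemma smooth_on_add:
  "open S \<Longrightarrow> smooth_on f S \<Longrightarrow> smooth_on g S \<Longrightarrow> smooth_on (\<lambda>z. f z + g z) S"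
  unfolding smooth_on_def using Ck_on_add by blast

lemma smooth_on_diff:
  assumes "open S" "smooth_on f S" "smooth_on g S"
  shows "smooth_on (\<lambda>z. f z - g z) S"
proof -
  have "smooth_on (\<lambda>z. - g z) S"
    using smooth_on_bounded_linear[OF assms(1) bounded_linear_minus[OF bounded_linear_ident] assms(3)] .
  then show ?thesis
    using smooth_on_add[OF assms(1,2), of "\<lambda>z. - g z"] by simp
qed

lemma smooth_on_cong:
  "open S \<Longrightarrow> (\<And>z. z \<in> S \<Longrightarrow> f z = g z) \<Longrightarrow> smooth_on f S \<Longrightarrow> smooth_on g S"
  unfolding smooth_on_def using Ck_on_cong by blast

text \<open>A function with a smooth derivative is smooth. This is how the primitive \<open>\<epsilon>\<close> inherits smoothness
  from its differential \<open>\<omega>\<close> in every chart.\<close>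

lemma smooth_onI_derivative:
  assumes S: "open S" and f: "\<And>z. z \<in> S \<Longrightarrow> (f has_derivative f' z) (at z)"
    and f': "\<And>w. smooth_on (\<lambda>z. f' z w) S"
  shows "smooth_on f S"
  unfolding smooth_on_def
proof
  fix k
  have "Ck_on (Suc k) f S"
    using Ck_on_SucI[OF S f] f' by (auto simp: smooth_on_def)
  then show "Ck_on k f S" by (rule Ck_on_mono_Suc)
qed

text \<open>The mean value inequality for the difference \<open>s \<mapsto> f (z + s v + h w) - f (z + s v) - s h B w\<close> on
  \<open>[0, h]\<close>: its derivative is of order \<open>o(h)\<close> because \<open>x \<mapsto> f' x v\<close> is differentiable at \<open>z\<close>. Thus
  \<open>B w\<close>, the second derivative in the directions \<open>v\<close>, \<open>w\<close>, is the limit of \<open>h\<^sup>-\<^sup>2\<close> times an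
  expression that is symmetric in \<open>v\<close> and \<open>w\<close>.\<close>

lemma double_difference_approx:
  fixes f :: "'a::real_normed_vector \<Rightarrow> 'b::real_normed_vector"
  assumes "open S" "z \<in> S" and f: "\<And>x. x \<in> S \<Longrightarrow> (f has_derivative f' x) (at x)"
    and g: "((\<lambda>x. f' x v) has_derivative B) (at z)" and "e > 0"
  shows "\<forall>\<^sub>F h in at_right (0::real).
    norm (f (z + h *\<^sub>R v + h *\<^sub>R w) - f (z + h *\<^sub>R v) - f (z + h *\<^sub>R w) + f z - h\<^sup>2 *\<^sub>R B w) \<le> e * h\<^sup>2"
proof -
  \<comment> \<open>Both evaluation points lie within \<open>h (\<bar>v\<bar> + \<bar>w\<bar>)\<close> of \<open>z\<close>; the two error terms then add up to at
    most \<open>e h\<close>. The summand 1 keeps \<open>C\<close> positive.\<close>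
  define C where "C = 2 * (norm v + norm w) + 1"
  have C: "C > 0" "2 * (norm v + norm w) \<le> C" "norm v + norm w \<le> C"
    using norm_ge_zero[of v] norm_ge_zero[of w] unfolding C_def by argo+
  obtain d where d: "d > 0" "\<And>y. norm (y - z) < d \<Longrightarrow> norm (f' y v - f' z v - B (y - z)) \<le> e / C * norm (y - z)"
    using g \<open>e > 0\<close> C unfolding has_derivative_at_alt by (metis divide_pos_pos)
  obtain r where r: "r > 0" "ball z r \<subseteq> S"
    using assms(1,2) open_contains_ball by blast
  define \<eta> where "\<eta> = min d r / C"
  have \<eta>: "\<eta> > 0"
    using d r C by (simp add: \<eta>_def)
  have bl: "linear B"
    using g has_derivative_linear by blast
  have main: "norm (f (z + h *\<^sub>R v + h *\<^sub>R w) - f (z + h *\<^sub>R v) - f (z + h *\<^sub>R w) + f z - h\<^sup>2 *\<^sub>R B w) \<le> e * h\<^sup>2"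
    if h: "0 < h" "h < \<eta>" for h
  proof -
    have hC: "h * C < min d r"
      using h C by (simp add: \<eta>_def pos_less_divide_eq)
    have small: "norm (s *\<^sub>R v + t *\<^sub>R w) \<le> h * (norm v + norm w)" if "s \<in> {0..h}" "t \<in> {0..h}" for s t
    proof -
      have "norm (s *\<^sub>R v + t *\<^sub>R w) \<le> s * norm v + t * norm w"
        using that norm_triangle_ineq[of "s *\<^sub>R v" "t *\<^sub>R w"] by simp
      also have "\<dots> \<le> h * norm v + h * norm w"
        using that by (intro add_mono mult_right_mono) auto
      finally show ?thesis by (simp add: algebra_simps)
    qed
    have less: "h * (norm v + norm w) < min d r"
      using hC C(3) h by (smt (verit) mult_left_mono)
    have inS: "z + s *\<^sub>R v + t *\<^sub>R w \<in> S" if "s \<in> {0..h}" "t \<in> {0..h}" for s t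
    proof -
      have "norm (s *\<^sub>R v + t *\<^sub>R w) < r"
        using small[OF that] less by simp
      then have "z + s *\<^sub>R v + t *\<^sub>R w \<in> ball z r"
        unfolding mem_ball by (subst dist_commute) (simp add: dist_norm add.assoc)
      then show ?thesis using r by blast
    qed
    define \<phi> where "\<phi> s = f (z + s *\<^sub>R v + h *\<^sub>R w) - f (z + s *\<^sub>R v) - (s * h) *\<^sub>R B w" for s
    have der: "(\<phi> has_derivative (\<lambda>t. t *\<^sub>R (f' (z + s *\<^sub>R v + h *\<^sub>R w) v - f' (z + s *\<^sub>R v) v - h *\<^sub>R B w)))
        (at s within {0..h})" if s: "s \<in> {0..h}" for s
    proof -
      have 1: "((\<lambda>s. z + s *\<^sub>R v + h *\<^sub>R w) has_derivative (\<lambda>t. t *\<^sub>R v)) (at s within {0..h})"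
        and 2: "((\<lambda>s. z + s *\<^sub>R v) has_derivative (\<lambda>t. t *\<^sub>R v)) (at s within {0..h})"
        by (auto intro!: derivative_eq_intros)
      have S: "z + s *\<^sub>R v + h *\<^sub>R w \<in> S" "z + s *\<^sub>R v \<in> S"
        using inS[OF s, of h] inS[OF s, of 0] h by auto
      have lin: "linear (f' (z + s *\<^sub>R v + h *\<^sub>R w))" "linear (f' (z + s *\<^sub>R v))"
        using f S has_derivative_linear by blast+
      have "((\<lambda>s. f (z + s *\<^sub>R v + h *\<^sub>R w)) has_derivative (\<lambda>t. t *\<^sub>R f' (z + s *\<^sub>R v + h *\<^sub>R w) v)) (at s within {0..h})"
        "((\<lambda>s. f (z + s *\<^sub>R v)) has_derivative (\<lambda>t. t *\<^sub>R f' (z + s *\<^sub>R v) v)) (at s within {0..h})"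
        using has_derivative_compose[OF 1 f[OF S(1)]] has_derivative_compose[OF 2 f[OF S(2)]]
        unfolding linear_scale[OF lin(1)] linear_scale[OF lin(2)] .
      moreover have "((\<lambda>s. (s * h) *\<^sub>R B w) has_derivative (\<lambda>t. (t * h) *\<^sub>R B w)) (at s within {0..h})"
        by (auto intro!: derivative_eq_intros)
      ultimately show ?thesis
        unfolding \<phi>_def
        by (auto intro!: derivative_eq_intros simp: scaleR_diff_right)
    qed
    have bound: "onorm (\<lambda>t. t *\<^sub>R (f' (z + s *\<^sub>R v + h *\<^sub>R w) v - f' (z + s *\<^sub>R v) v - h *\<^sub>R B w)) \<le> e * h"
      if s: "s \<in> {0..h}" for s
    proof -
      define y1 where "y1 = z + s *\<^sub>R v + h *\<^sub>R w"
      define y2 where "y2 = z + s *\<^sub>R v"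
      have n1: "norm (y1 - z) \<le> h * (norm v + norm w)"
        using small[OF s, of h] h by (simp add: y1_def)
      have n2: "norm (y2 - z) \<le> h * (norm v + norm w)"
        using small[OF s, of 0] h by (simp add: y2_def)
      have "f' y1 v - f' y2 v - h *\<^sub>R B w = (f' y1 v - f' z v - B (y1 - z)) - (f' y2 v - f' z v - B (y2 - z))"
        by (simp add: y1_def y2_def linear_add[OF bl] linear_scale[OF bl])
      also have "norm \<dots> \<le> e / C * norm (y1 - z) + e / C * norm (y2 - z)"
        using d(2)[of y1] d(2)[of y2] n1 n2 less
          norm_triangle_ineq4[of "f' y1 v - f' z v - B (y1 - z)" "f' y2 v - f' z v - B (y2 - z)"]
        by (smt (verit))
      also have "\<dots> = e / C * (norm (y1 - z) + norm (y2 - z))"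
        by (simp add: algebra_simps)
      also have "\<dots> \<le> e / C * (h * C)"
      proof (rule mult_left_mono)
        have "norm (y1 - z) + norm (y2 - z) \<le> h * (2 * (norm v + norm w))"
          using n1 n2 by (simp add: algebra_simps)
        also have "\<dots> \<le> h * C"
          using C h by (intro mult_left_mono) auto
        finally show "norm (y1 - z) + norm (y2 - z) \<le> h * C" .
      qed (use \<open>e > 0\<close> C in auto)
      also have "\<dots> = e * h"
        using C by simp
      finally have "norm (f' y1 v - f' y2 v - h *\<^sub>R B w) \<le> e * h" .
      then show ?thesis
        unfolding y1_def y2_def
        by (intro onorm_le) (simp add: mult.commute[of "e * h"] mult_left_mono)
    qed
    have "norm (\<phi> h - \<phi> 0) \<le> e * h * norm (h - 0)"
      by (rule differentiable_bound[of "{0..h}"]) (use der bound h in auto)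
    moreover have "\<phi> h - \<phi> 0 = f (z + h *\<^sub>R v + h *\<^sub>R w) - f (z + h *\<^sub>R v) - f (z + h *\<^sub>R w) + f z - h\<^sup>2 *\<^sub>R B w"
      by (simp add: \<phi>_def power2_eq_square)
    ultimately show ?thesis
      using h by (simp add: power2_eq_square mult.assoc)
  qed
  then show ?thesis
    unfolding eventually_at_right_field using \<eta> by blast
qed

lemma symmetric_second_derivative:
  fixes f :: "'a::real_normed_vector \<Rightarrow> 'b::real_normed_vector"
  assumes S: "open S" "z \<in> S" and f: "\<And>x. x \<in> S \<Longrightarrow> (f has_derivative f' x) (at x)"
    and B: "((\<lambda>x. f' x v) has_derivative B) (at z)" and C: "((\<lambda>x. f' x w) has_derivative C) (at z)"
  shows "B w = C v"
proof (rule ccontr)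
  assume "B w \<noteq> C v"
  define e where "e = norm (B w - C v) / 3"
  have e: "e > 0"
    using \<open>B w \<noteq> C v\<close> by (simp add: e_def)
  have "\<forall>\<^sub>F h in at_right (0::real). h > 0"
    by (simp add: eventually_at_right_less)
  moreover note double_difference_approx[OF S f B e, of w, simplified]
    double_difference_approx[OF S f C e, of v, simplified]
  ultimately have "\<forall>\<^sub>F h in at_right (0::real). False"
  proof eventually_elim
    case (elim h)
    define \<Delta> where "\<Delta> = f (z + h *\<^sub>R v + h *\<^sub>R w) - f (z + h *\<^sub>R v) - f (z + h *\<^sub>R w) + f z"
    have 1: "norm (\<Delta> - h\<^sup>2 *\<^sub>R B w) \<le> e * h\<^sup>2"
      using elim(2) by (simp add: \<Delta>_def)
    have 2: "norm (\<Delta> - h\<^sup>2 *\<^sub>R C v) \<le> e * h\<^sup>2"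
      using elim(3) by (simp add: \<Delta>_def algebra_simps)
    have "h\<^sup>2 * norm (B w - C v) = norm ((\<Delta> - h\<^sup>2 *\<^sub>R C v) - (\<Delta> - h\<^sup>2 *\<^sub>R B w))"
      by (simp add: flip: scaleR_diff_right)
    also have "\<dots> \<le> e * h\<^sup>2 + e * h\<^sup>2"
      using norm_triangle_ineq4[of "\<Delta> - h\<^sup>2 *\<^sub>R C v" "\<Delta> - h\<^sup>2 *\<^sub>R B w"] 1 2 by linarith
    finally have "h\<^sup>2 * (3 * e) \<le> h\<^sup>2 * (2 * e)"
      by (simp add: e_def algebra_simps)
    then show False
      using e elim(1) by (simp add: mult_le_cancel_left)
  qed
  then show False
    by simp
qed

lemma smooth_on_continuous: "smooth_on f S \<Longrightarrow> continuous_on S f"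
  unfolding smooth_on_def using Ck_on_continuous by blast

text \<open>The Poincare lemma on a disc, for the form \<open>e du + f dv\<close>: integrate along the ray from the centre
  and differentiate under the integral. By closedness the integrand becomes the \<open>t\<close>-derivative of
  \<open>t \<omega>(z0 + t (z - z0)) w\<close>.\<close>

lemma closed_form_primitive:
  fixes e f :: "complex \<Rightarrow> 'b::banach"
  assumes B: "B = ball z0 r"
    and e: "\<And>z. z \<in> B \<Longrightarrow> (e has_derivative De z) (at z)"
    and f: "\<And>z. z \<in> B \<Longrightarrow> (f has_derivative Df z) (at z)"
    and cont: "\<And>w. continuous_on B (\<lambda>z. De z w)" "\<And>w. continuous_on B (\<lambda>z. Df z w)"
    and closed: "\<And>z. z \<in> B \<Longrightarrow> De z \<i> = Df z 1"
  obtains F where "\<And>z. z \<in> B \<Longrightarrow> (F has_derivative (\<lambda>w. Re w *\<^sub>R e z + Im w *\<^sub>R f z)) (at z)"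
proof -
  define \<gamma> where "\<gamma> z t = z0 + t *\<^sub>R (z - z0)" for z and t :: real
  define \<omega> where "\<omega> z w = Re w *\<^sub>R e z + Im w *\<^sub>R f z" for z w
  define D\<omega> where "D\<omega> z w v = Re w *\<^sub>R De z v + Im w *\<^sub>R Df z v" for z w v
  define F where "F z = integral {0..1} (\<lambda>t. \<omega> (\<gamma> z t) (z - z0))" for z
  have op: "open B" and conv: "convex B"
    by (auto simp: B)
  have lin: "linear (De z)" "linear (Df z)" if "z \<in> B" for z
    using e f that has_derivative_linear by blast+
  have split: "De z v = Re v *\<^sub>R De z 1 + Im v *\<^sub>R De z \<i>" "Df z v = Re v *\<^sub>R Df z 1 + Im v *\<^sub>R Df z \<i>"
    if "z \<in> B" for z v
  proof -
    have v: "v = Re v *\<^sub>R 1 + Im v *\<^sub>R \<i>"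
      by (simp add: complex_eq_iff)
    show "De z v = Re v *\<^sub>R De z 1 + Im v *\<^sub>R De z \<i>" "Df z v = Re v *\<^sub>R Df z 1 + Im v *\<^sub>R Df z \<i>"
      by (subst v, simp only: linear_add[OF lin(1)[OF that]] linear_scale[OF lin(1)[OF that]]
          linear_add[OF lin(2)[OF that]] linear_scale[OF lin(2)[OF that]])+
  qed
  have \<gamma>: "\<gamma> z t \<in> B" if "z \<in> B" "t \<in> {0..1}" for z t
  proof -
    have "norm (t *\<^sub>R (z - z0)) \<le> 1 * norm (z - z0)"
      unfolding norm_scaleR using that by (intro mult_right_mono) auto
    then show ?thesis
      using that by (simp add: B \<gamma>_def dist_norm norm_minus_commute)
  qed
  have sym: "D\<omega> z w v = D\<omega> z v w" if "z \<in> B" for z w v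
    unfolding D\<omega>_def split[OF that, of v] split[OF that, of w] closed[OF that]
    by (simp add: algebra_simps)
  define fx where "fx z t = Blinfun (\<lambda>w. t *\<^sub>R D\<omega> (\<gamma> z t) (z - z0) w + \<omega> (\<gamma> z t) w)" for z t
  have fx: "blinfun_apply (fx z t) = (\<lambda>w. t *\<^sub>R D\<omega> (\<gamma> z t) (z - z0) w + \<omega> (\<gamma> z t) w)"
    if "z \<in> B" "t \<in> {0..1}" for z t
  proof -
    have "bounded_linear (De (\<gamma> z t))" "bounded_linear (Df (\<gamma> z t))"
      using e f \<gamma>[OF that] has_derivative_bounded_linear by blast+
    then have "bounded_linear (\<lambda>w. t *\<^sub>R D\<omega> (\<gamma> z t) (z - z0) w + \<omega> (\<gamma> z t) w)"
      unfolding D\<omega>_def \<omega>_def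
      by (intro bounded_linear_add bounded_linear_const_scaleR bounded_linear_scaleR_left
          bounded_linear_compose[OF bounded_linear_scaleR_left bounded_linear_Re]
          bounded_linear_compose[OF bounded_linear_scaleR_left bounded_linear_Im])
    then show ?thesis
      unfolding fx_def by (rule bounded_linear_Blinfun_apply)
  qed
  have cont_\<gamma>: "continuous_on (B \<times> {0..1}) (\<lambda>(z, t). \<gamma> z t)"
    unfolding \<gamma>_def split_def by (intro continuous_intros)
  have cont_e: "continuous_on B e" "continuous_on B f"
    using e f by (meson continuous_at_imp_continuous_on has_derivative_continuous)+
  have comp: "continuous_on (B \<times> {0..1}) (\<lambda>x. k (\<gamma> (fst x) (snd x)))" if "continuous_on B k" for k :: "complex \<Rightarrow> 'b"
  proof -
    have "(\<lambda>x. \<gamma> (fst x) (snd x)) ` (B \<times> {0..1}) \<subseteq> B"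
      using \<gamma> by force
    then show ?thesis
      using continuous_on_compose2[OF that cont_\<gamma>] by (simp add: split_def)
  qed
  have cont_fx: "continuous_on (B \<times> cbox 0 1) (\<lambda>(z, t). fx z t)"
  proof (rule continuous_on_blinfun_componentwise)
    fix i :: complex assume "i \<in> Basis"
    have "continuous_on (B \<times> {0..1}) (\<lambda>x. snd x *\<^sub>R D\<omega> (\<gamma> (fst x) (snd x)) (fst x - z0) i + \<omega> (\<gamma> (fst x) (snd x)) i)"
      unfolding D\<omega>_def \<omega>_def
      by (intro continuous_intros comp cont cont_e)
    then show "continuous_on (B \<times> cbox 0 1) (\<lambda>x. blinfun_apply (case x of (z, t) \<Rightarrow> fx z t) i)"
      unfolding cbox_interval by (rule continuous_on_eq) (auto simp: fx)
  qed
  have "(F has_derivative (\<lambda>w. Re w *\<^sub>R e z + Im w *\<^sub>R f z)) (at z)" if z: "z \<in> B" for z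
  proof -
    have der: "((\<lambda>x. \<omega> (\<gamma> x t) (x - z0)) has_derivative blinfun_apply (fx x t)) (at x within B)"
      if x: "x \<in> B" "t \<in> cbox 0 1" for x t
    proof -
      have \<gamma>': "((\<lambda>x. \<gamma> x t) has_derivative (\<lambda>w. t *\<^sub>R w)) (at x within B)"
        unfolding \<gamma>_def by (auto intro!: derivative_eq_intros)
      have B': "\<gamma> x t \<in> B"
        using \<gamma> x by simp
      note [derivative_intros] = has_derivative_compose[OF \<gamma>' e[OF B']] has_derivative_compose[OF \<gamma>' f[OF B']]
      have "((\<lambda>x. \<omega> (\<gamma> x t) (x - z0)) has_derivative
          (\<lambda>w. Re (x - z0) *\<^sub>R De (\<gamma> x t) (t *\<^sub>R w) + Re w *\<^sub>R e (\<gamma> x t)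
             + (Im (x - z0) *\<^sub>R Df (\<gamma> x t) (t *\<^sub>R w) + Im w *\<^sub>R f (\<gamma> x t)))) (at x within B)"
        unfolding \<omega>_def by (auto intro!: derivative_eq_intros)
      also have "(\<lambda>w. Re (x - z0) *\<^sub>R De (\<gamma> x t) (t *\<^sub>R w) + Re w *\<^sub>R e (\<gamma> x t)
             + (Im (x - z0) *\<^sub>R Df (\<gamma> x t) (t *\<^sub>R w) + Im w *\<^sub>R f (\<gamma> x t))) = blinfun_apply (fx x t)"
        using x by (simp add: fx \<omega>_def D\<omega>_def linear_scale[OF lin(1)[OF B']] linear_scale[OF lin(2)[OF B']]
            algebra_simps)
      finally show ?thesis .
    qed
    have path: "continuous_on {0..1} (\<gamma> x)" for x
      unfolding \<gamma>_def by (intro continuous_intros)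
    have int: "(\<lambda>t. \<omega> (\<gamma> x t) (x - z0)) integrable_on cbox 0 1" if "x \<in> B" for x
      unfolding \<omega>_def cbox_interval
      by (intro integrable_continuous_real continuous_intros continuous_on_compose2[OF cont_e(1) path]
          continuous_on_compose2[OF cont_e(2) path]) (use \<gamma> that in auto)
    have "(F has_derivative integral (cbox 0 1) (fx z)) (at z within B)"
      using leibniz_rule[OF der int cont_fx z conv] unfolding F_def cbox_interval .
    moreover have "blinfun_apply (integral (cbox 0 1) (fx z)) = \<omega> z"
    proof
      fix w
      have "continuous_on {0..1} (\<lambda>t. fx z t)"
        using continuous_on_compose2[OF cont_fx
            continuous_on_Pair[OF continuous_on_const[of _ z] continuous_on_id], of "{0..1}"] z
        by auto
      then have "fx z integrable_on cbox 0 1"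
        unfolding cbox_interval by (rule integrable_continuous_real)
      then have "blinfun_apply (integral (cbox 0 1) (fx z)) w = integral (cbox 0 1) (\<lambda>t. fx z t w)"
        by (rule blinfun_apply_integral)
      also have "\<dots> = integral {0..1} (\<lambda>t. t *\<^sub>R D\<omega> (\<gamma> z t) (z - z0) w + \<omega> (\<gamma> z t) w)"
        unfolding cbox_interval by (intro integral_cong) (simp add: fx z)
      also have "\<dots> = 1 *\<^sub>R \<omega> (\<gamma> z 1) w - 0 *\<^sub>R \<omega> (\<gamma> z 0) w"
      proof (rule integral_unique, rule fundamental_theorem_of_calculus)
        fix t :: real assume t: "t \<in> {0..1}"
        have B': "\<gamma> z t \<in> B"
          using \<gamma> z t by simp
        have \<gamma>': "(\<gamma> z has_derivative (\<lambda>s. s *\<^sub>R (z - z0))) (at t within {0..1})"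
          unfolding \<gamma>_def by (auto intro!: derivative_eq_intros)
        note [derivative_intros] = has_derivative_compose[OF \<gamma>' e[OF B']] has_derivative_compose[OF \<gamma>' f[OF B']]
        have "((\<lambda>t. t *\<^sub>R \<omega> (\<gamma> z t) w) has_derivative
           (\<lambda>s. t *\<^sub>R (Re w *\<^sub>R De (\<gamma> z t) (s *\<^sub>R (z - z0)) + Im w *\<^sub>R Df (\<gamma> z t) (s *\<^sub>R (z - z0)))
              + s *\<^sub>R \<omega> (\<gamma> z t) w)) (at t within {0..1})"
          unfolding \<omega>_def by (auto intro!: derivative_eq_intros)
        also have "(\<lambda>s. t *\<^sub>R (Re w *\<^sub>R De (\<gamma> z t) (s *\<^sub>R (z - z0)) + Im w *\<^sub>R Df (\<gamma> z t) (s *\<^sub>R (z - z0)))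
              + s *\<^sub>R \<omega> (\<gamma> z t) w) = (\<lambda>s. s *\<^sub>R (t *\<^sub>R D\<omega> (\<gamma> z t) w (z - z0) + \<omega> (\<gamma> z t) w))"
          unfolding D\<omega>_def linear_scale[OF lin(1)[OF B']] linear_scale[OF lin(2)[OF B']]
          by (simp add: algebra_simps)
        finally show "((\<lambda>t. t *\<^sub>R \<omega> (\<gamma> z t) w) has_vector_derivative
            t *\<^sub>R D\<omega> (\<gamma> z t) (z - z0) w + \<omega> (\<gamma> z t) w) (at t within {0..1})"
          unfolding has_vector_derivative_def sym[OF B', of "z - z0" w] .
      qed simp
      finally show "blinfun_apply (integral (cbox 0 1) (fx z)) w = \<omega> z w"
        by (simp add: \<gamma>_def)
    qed
    ultimately have "(F has_derivative \<omega> z) (at z within B)"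
      by simp
    then show ?thesis
      unfolding at_within_open[OF z op] \<omega>_def .
  qed
  then show ?thesis using that by blast
qed

section \<open>Left-invariant frames on the product of two three-spheres\<close>

definition qcnj :: "quat \<Rightarrow> quat" where
  "qcnj x = (fst x, - snd x)"

lemma qinv_S3: "x \<in> S3 \<Longrightarrow> qinv x = qcnj x"
  by (simp add: qinv_def qcnj_def)

lemma qmul_qcnj: "x \<odot> qcnj x = (x \<bullet> x, 0)"
  by (simp add: qmul_def qcnj_def inner_prod_def cross_minus_right)

lemma fst_qcnj_qmul: "fst (qcnj x \<odot> y) = x \<bullet> y"
  by (simp add: qmul_def qcnj_def inner_prod_def)

lemma qcnj_qmul: "qcnj (x \<odot> y) = qcnj y \<odot> qcnj x"
  by (simp add: qmul_def qcnj_def inner_commute cross_minus_left cross_minus_right cross_skew[of "snd y" "snd x"])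

text \<open>The adjoint of left multiplication by \<open>x\<close> is left multiplication by its conjugate.\<close>

lemma qmul_left_isometry: "(x \<odot> y) \<bullet> (x \<odot> z) = (x \<bullet> x) * (y \<bullet> z)"
proof -
  have "qcnj x \<odot> x = (x \<bullet> x, 0)"
    by (simp add: qmul_def qcnj_def inner_prod_def cross_minus_left)
  then have "(qcnj x \<odot> x) \<odot> z = (x \<bullet> x) *\<^sub>R z"
    by (simp only:) (simp add: qmul_def prod_eq_iff)
  then have "qcnj (x \<odot> y) \<odot> (x \<odot> z) = (x \<bullet> x) *\<^sub>R (qcnj y \<odot> z)"
    by (simp only: qcnj_qmul qmul_assoc qmul_scaleR_right)
  then show ?thesis
    using fst_qcnj_qmul[of "x \<odot> y" "x \<odot> z"] fst_qcnj_qmul[of y z] by simp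
qed

lemma S3_inner: "x \<in> S3 \<Longrightarrow> x \<bullet> x = 1"
  by (simp add: dot_square_norm)

lemma qmul_add_left: "(x + y) \<odot> z = x \<odot> z + y \<odot> z"
  by (simp add: qmul_def inner_add_left cross_add_left algebra_simps)

lemma qmul_scaleR_left: "(a *\<^sub>R x) \<odot> y = a *\<^sub>R (x \<odot> y)"
  by (simp add: qmul_def cross_mult_left algebra_simps)

lemma bounded_bilinear_qmul: "bounded_bilinear (\<odot>)"
proof
  show "\<exists>K. \<forall>x y. norm (x \<odot> y) \<le> norm x * norm y * K"
  proof (intro exI allI)
    fix x y
    have "(norm (x \<odot> y))\<^sup>2 = (norm x * norm y)\<^sup>2"
      by (simp only: power_mult_distrib power2_norm_eq_inner qmul_left_isometry)
    then have "norm (x \<odot> y) = norm x * norm y"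
      by (simp add: power2_eq_iff_nonneg)
    then show "norm (x \<odot> y) \<le> norm x * norm y * 1"
      by simp
  qed
qed (simp_all add: qmul_add_left qmul_add_right qmul_scaleR_left qmul_scaleR_right)

lemma bounded_linear_qcnj: "bounded_linear qcnj"
  unfolding qcnj_def
  by (intro bounded_linear_Pair bounded_linear_fst bounded_linear_minus bounded_linear_snd)

text \<open>The tangent vector at \<open>r = (p, q)\<close> obtained from the pair of imaginary quaternions \<open>(a, c)\<close> by left
  translation. In these coordinates \<open>J\<close>, \<open>P\<close> and \<open>g\<close> have constant coefficients.\<close>

definition frame :: "quat \<times> quat \<Rightarrow> real^3 \<Rightarrow> real^3 \<Rightarrow> quat \<times> quat" where
  "frame r a c = (fst r \<odot> (0, a), snd r \<odot> (0, c))"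

text \<open>The difference of the Maurer-Cartan forms of the two factors; its pull-back along \<open>\<phi>\<close> is the
  differential of the surface in \<open>\<real>\<^sup>3\<close> to be constructed.\<close>

definition body_diff :: "quat \<times> quat \<Rightarrow> quat \<times> quat \<Rightarrow> real^3" where
  "body_diff r X = snd (qinv (snd r) \<odot> snd X) - snd (qinv (fst r) \<odot> fst X)"

text \<open>A vector \<open>U\<close> is tangent to the sphere at \<open>p\<close> iff \<open>p\<^sup>-\<^sup>1 U\<close> is imaginary, its real part being
  \<open>\<langle>p, U\<rangle>\<close>.\<close>

lemma S3_tangent_eq:
  assumes "p \<in> S3" "p \<bullet> U = 0"
  shows "U = p \<odot> (0, snd (qinv p \<odot> U))"
proof -
  have "qinv p \<odot> U = (0, snd (qinv p \<odot> U))"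
    using assms fst_qcnj_qmul[of p U] by (simp add: qinv_S3 prod_eq_iff)
  then have "p \<odot> (0, snd (qinv p \<odot> U)) = p \<odot> (qinv p \<odot> U)"
    by metis
  also have "\<dots> = (p \<odot> qinv p) \<odot> U"
    by (simp only: qmul_assoc)
  also have "\<dots> = U"
    using assms(1) by (simp add: qinv_S3 qmul_qcnj S3_inner qmul_one)
  finally show ?thesis by simp
qed

lemma qinv_qmul_cancel: "p \<in> S3 \<Longrightarrow> qinv p \<odot> (p \<odot> X) = X"
  by (simp add: qinv_qmul qmul_one flip: qmul_assoc)

lemma frame_add: "frame r a c + frame r a' c' = frame r (a + a') (c + c')"
  by (simp add: frame_def flip: qmul_add_right)

lemma frame_scaleR: "s *\<^sub>R frame r a c = frame r (s *\<^sub>R a) (s *\<^sub>R c)"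
  by (simp add: frame_def flip: qmul_scaleR_right)

context
  fixes r :: "quat \<times> quat"
  assumes r: "r \<in> S3 \<times> S3"
begin

lemma fst_snd_S3: "fst r \<in> S3" "snd r \<in> S3"
  using r by auto

lemma frame_inject: "frame r a c = frame r a' c' \<longleftrightarrow> a = a' \<and> c = c'"
proof
  assume "frame r a c = frame r a' c'"
  then have "fst r \<odot> (0, a) = fst r \<odot> (0, a')" "snd r \<odot> (0, c) = snd r \<odot> (0, c')"
    by (auto simp: frame_def)
  then have "(0::real, a) = (0, a')" "(0::real, c) = (0, c')"
    using qinv_qmul_cancel fst_snd_S3 by metis+
  then show "a = a' \<and> c = c'" by simp
qed simp

lemma inner_frame: "frame r a c \<bullet> frame r a' c' = a \<bullet> a' + c \<bullet> c'"
  using fst_snd_S3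
  by (simp add: frame_def inner_prod_def[of "(_, _)"] qmul_left_isometry S3_inner del: mem_sphere_0)

lemma body_diff_frame: "body_diff r (frame r a c) = c - a"
  using fst_snd_S3 by (simp add: body_diff_def frame_def qinv_qmul_cancel del: mem_sphere_0)

lemma nk_P_frame: "nk_P r (frame r a c) = frame r c a"
  using fst_snd_S3
  by (simp add: nk_P_def Let_def frame_def qinv_qmul_cancel qmul_assoc del: mem_sphere_0)

lemma nk_J_frame:
  "nk_J r (frame r a c) = frame r ((1 / sqrt 3) *\<^sub>R (2 *\<^sub>R c - a)) ((1 / sqrt 3) *\<^sub>R (c - 2 *\<^sub>R a))"
proof -
  have q: "qinv (snd r) \<odot> (snd r \<odot> X) = X" "qinv (fst r) \<odot> (fst r \<odot> X) = X" for X
    using fst_snd_S3 qinv_qmul_cancel by blast+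
  have lin: "linear (\<lambda>x. p \<odot> (0, x))" for p
    by (rule linearI) (simp_all flip: qmul_add_right qmul_scaleR_right)
  have "nk_J r (frame r a c) = (1 / sqrt 3) *\<^sub>R
      (2 *\<^sub>R (fst r \<odot> (0, c)) - fst r \<odot> (0, a), - (2 *\<^sub>R (snd r \<odot> (0, a))) + snd r \<odot> (0, c))"
    by (simp only: nk_J_def Let_def frame_def fst_conv snd_conv qmul_assoc q)
  then show ?thesis
    by (simp add: frame_def linear_scale[OF lin] linear_diff[OF lin])
qed

lemma nk_g_frame:
  "nk_g r (frame r a c) (frame r a' c') =
    4/3 * (a \<bullet> a' + c \<bullet> c' - (a \<bullet> c' + c \<bullet> a') / 2)"
  unfolding nk_g_def nk_J_frame inner_frame
  by (simp add: inner_diff_left inner_diff_right field_simps)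

text \<open>For \<open>Z = (X - \<i>JX) / 2\<close> with \<open>X = (a, c)\<close>, the real part of \<open>g (P Z) Z\<close> is a multiple of
  \<open>4 \<langle>a, c\<rangle> - \<bar>a\<bar>\<^sup>2 - \<bar>c\<bar>\<^sup>2\<close>. When it vanishes, \<open>\<bar>c - a\<bar>\<^sup>2 = 2 \<langle>a, c\<rangle>\<close> and \<open>g X X = 4 \<langle>a, c\<rangle>\<close>.\<close>

lemma norm_body_diff:
  assumes X: "X = frame r a c"
    and L: "gC r (PC r ((1/2) *\<^sub>R X, - ((1/2) *\<^sub>R nk_J r X))) ((1/2) *\<^sub>R X, - ((1/2) *\<^sub>R nk_J r X)) = 0"
  shows "body_diff r X \<bullet> body_diff r X = 1/2 * nk_g r X X"
proof -
  have neg: "- frame r a c = frame r (- a) (- c)" for a c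
    using frame_scaleR[of "-1" r a c] by simp
  have "Re (gC r (PC r ((1/2) *\<^sub>R X, - ((1/2) *\<^sub>R nk_J r X))) ((1/2) *\<^sub>R X, - ((1/2) *\<^sub>R nk_J r X))) =
     2/3 * (2 * (a \<bullet> c) - (a \<bullet> a + c \<bullet> c) / 2)"
    by (simp add: X gC_def PC_def nk_J_frame nk_P_frame frame_scaleR neg nk_g_frame
        inner_diff_left inner_diff_right inner_commute[of c a] field_simps)
  then have "a \<bullet> a + c \<bullet> c = 4 * (a \<bullet> c)"
    using L by simp
  then show ?thesis
    by (simp add: X body_diff_frame nk_g_frame inner_diff_left inner_diff_right inner_commute[of c a])
qed

text \<open>Both components of \<open>J (a, c)\<close> are combinations of \<open>a\<close> and \<open>c\<close>, so for a plane spanned by \<open>X\<close> and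
  \<open>JX\<close> the three cross products are multiples of \<open>a \<times> c\<close>; the coefficients agree because of the
  special form \<open>(2c - a, c - 2a)\<close>. The first equation is the reason why \<open>\<omega>\<close> is closed.\<close>

lemma cross_frame:
  assumes "frame r a' c' = s *\<^sub>R frame r a c + t *\<^sub>R nk_J r (frame r a c)"
  shows "cross3 c c' = cross3 a a'" "cross3 (c - a) (c' - a') = cross3 a a'"
proof -
  define u where "u = t / sqrt 3"
  have eqs: "a' = s *\<^sub>R a + u *\<^sub>R (2 *\<^sub>R c - a)" "c' = s *\<^sub>R c + u *\<^sub>R (c - 2 *\<^sub>R a)"
    using assms unfolding nk_J_frame frame_scaleR frame_add frame_inject u_def by simp_all
  show "cross3 c c' = cross3 a a'" "cross3 (c - a) (c' - a') = cross3 a a'"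
    unfolding eqs by (simp_all add: cross3_def vec_eq_iff forall_3 algebra_simps)
qed

end

lemma nk_g_polarization:
  "nk_g r (X + Y) (X + Y) = nk_g r X X + nk_g r Y Y + 2 * nk_g r X Y"
  unfolding nk_g_def linear_add[OF linear_nk_J] inner_add_left inner_add_right
    inner_commute[of Y X] inner_commute[of "nk_J r Y" "nk_J r X"]
  by argo

section \<open>Mean curvature from a normal conjugate form\<close>

lemma matrix_inv_2:
  fixes p q r s D :: real
  assumes D: "p * s - q * r = D" "D \<noteq> 0"
  shows "matrix_inv (vector [vector [p, q], vector [r, s]] :: real^2^2) =
    vector [vector [s / D, - q / D], vector [- r / D, p / D]]"
    (is "matrix_inv ?A = ?B")
proof -
  have one: "p * s / D - q * r / D = 1"
    using D by (simp flip: diff_divide_distrib)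
  have AB: "?A ** ?B = mat 1" "?B ** ?A = mat 1"
    using one by (simp_all add: vec_eq_iff forall_2 matrix_matrix_mult_def sum_2 mat_def mult.commute)
  then have "matrix_inv ?A ** ?A = mat 1"
    unfolding matrix_inv_def by - (rule someI2[where a = ?B], auto)
  then have "matrix_inv ?A ** (?A ** ?B) = ?B"
    by (simp add: matrix_mul_assoc)
  then show ?thesis
    by (simp only: AB matrix_mul_rid)
qed

text \<open>Pointwise form of the curvature computation. Here \<open>e = \<epsilon>\<^sub>u\<close>, \<open>f = \<epsilon>\<^sub>v\<close>, and \<open>k1\<close>, \<open>k2\<close> are the
  components of \<open>\<kappa> = d\<epsilon> \<circ> J\<close>; the vectors with suffix \<open>u\<close> or \<open>v\<close> stand for partial derivatives.
  The coordinates need not be isothermal: \<open>\<partial>\<^sub>v = a \<partial>\<^sub>u + b J \<partial>\<^sub>u\<close>. The hypotheses \<open>d1\<close> and \<open>d2\<close> are the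
  derivatives of \<open>\<langle>\<kappa>, N\<rangle> = 0\<close>; they give the normal parts of \<open>k1v\<close> and \<open>k2u\<close> without derivatives of
  the coefficients \<open>a\<close> and \<open>b\<close>. The normal part of their difference is, up to a factor, the
  trace of the second fundamental form with respect to the first.\<close>

lemma mean_curvature_algebra:
  fixes e f k1 k2 eu ev fu fv k1v k2u :: "real^3"
  assumes f: "f = a *\<^sub>R e + b *\<^sub>R k1" and k2: "k2 = a *\<^sub>R k1 - b *\<^sub>R e" and b: "b > 0"
    and perp: "e \<bullet> k1 = 0" "k1 \<bullet> k1 = e \<bullet> e" "e \<noteq> 0"
    and N: "N = cross3 e f"
    and d1: "k1v \<bullet> N + k1 \<bullet> (cross3 ev f + cross3 e fv) = 0"
    and d2: "k2u \<bullet> N + k2 \<bullet> (cross3 eu f + cross3 e fu) = 0"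
    and d: "k2u - k1v = (4 / sqrt 3) *\<^sub>R N"
  shows "1/2 * trace (matrix_inv (vector [vector [e \<bullet> e, e \<bullet> f], vector [f \<bullet> e, f \<bullet> f]] :: real^2^2) **
     vector [vector [eu \<bullet> (N /\<^sub>R norm N), fu \<bullet> (N /\<^sub>R norm N)],
             vector [ev \<bullet> (N /\<^sub>R norm N), fv \<bullet> (N /\<^sub>R norm N)]]) = - 2 / sqrt 3"
proof -
  define E where "E = e \<bullet> e"
  have E: "E > 0"
    using perp(3) by (simp add: E_def)
  have F: "e \<bullet> f = a * E" "f \<bullet> e = a * E" and G: "f \<bullet> f = (a\<^sup>2 + b\<^sup>2) * E"
    using perp by (simp_all add: f E_def inner_add_left inner_add_right inner_commute[of k1 e]
        power2_eq_square algebra_simps)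
  have "N \<bullet> N = (e \<bullet> e) * (f \<bullet> f) - (e \<bullet> f)\<^sup>2"
    unfolding N by (simp add: cross3_def inner_vec_def sum_3 power2_eq_square algebra_simps)
  also have "\<dots> = (b * E)\<^sup>2"
    unfolding F G E_def[symmetric] by (simp add: power2_eq_square algebra_simps)
  finally have NN: "N \<bullet> N = (b * E)\<^sup>2" .
  then have nN: "norm N = b * E"
    using b E by (simp add: norm_eq_sqrt_inner)
  have t1: "f \<bullet> cross3 e x = - (x \<bullet> N)" "e \<bullet> cross3 x f = - (x \<bullet> N)"
      "f \<bullet> cross3 x f = 0" "e \<bullet> cross3 e x = 0" for x
    unfolding N by (simp_all add: cross3_def inner_vec_def sum_3 algebra_simps)
  \<comment> \<open>\<open>k1\<close> and \<open>k2\<close> are expressed by \<open>e\<close> and \<open>f\<close>, whose scalar products with the derivative of \<open>N\<close>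
    are triple products of the form \<open>t1\<close>.\<close>
  have bk1: "b *\<^sub>R k1 = f - a *\<^sub>R e"
    by (simp add: f)
  have bk2: "b *\<^sub>R k2 = a *\<^sub>R f - (a\<^sup>2 + b\<^sup>2) *\<^sub>R e"
    by (simp add: f k2 power2_eq_square algebra_simps)
  have "b * (k1v \<bullet> N) = - ((b *\<^sub>R k1) \<bullet> (cross3 ev f + cross3 e fv))"
    using d1 by (simp only: inner_scaleR_left eq_neg_iff_add_eq_0 flip: distrib_left)
  also have "\<dots> = fv \<bullet> N - a * (ev \<bullet> N)"
    unfolding bk1 by (simp add: inner_diff_left inner_add_right t1)
  finally have 1: "b * (k1v \<bullet> N) = fv \<bullet> N - a * (ev \<bullet> N)" .
  have "b * (k2u \<bullet> N) = - ((b *\<^sub>R k2) \<bullet> (cross3 eu f + cross3 e fu))"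
    using d2 by (simp only: inner_scaleR_left eq_neg_iff_add_eq_0 flip: distrib_left)
  also have "\<dots> = a * (fu \<bullet> N) - (a\<^sup>2 + b\<^sup>2) * (eu \<bullet> N)"
    unfolding bk2 by (simp add: inner_diff_left inner_add_right t1)
  finally have 2: "b * (k2u \<bullet> N) = a * (fu \<bullet> N) - (a\<^sup>2 + b\<^sup>2) * (eu \<bullet> N)" .
  have "b * ((k2u - k1v) \<bullet> N) = b * (4 / sqrt 3) * (b * E)\<^sup>2"
    unfolding d by (simp add: NN)
  then have S: "(a\<^sup>2 + b\<^sup>2) * (eu \<bullet> N) - a * (fu \<bullet> N) - a * (ev \<bullet> N) + fv \<bullet> N =
      - (4 / sqrt 3) * b * (b * E)\<^sup>2"
    using 1 2 by (simp add: inner_diff_left algebra_simps)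
  have det: "(e \<bullet> e) * (f \<bullet> f) - (e \<bullet> f) * (f \<bullet> e) = (b * E)\<^sup>2"
    unfolding F G E_def[symmetric] by (simp add: power2_eq_square algebra_simps)
  have det0: "(b * E)\<^sup>2 \<noteq> 0"
    using b E by simp
  have "trace (matrix_inv (vector [vector [e \<bullet> e, e \<bullet> f], vector [f \<bullet> e, f \<bullet> f]] :: real^2^2) **
     vector [vector [eu \<bullet> (N /\<^sub>R norm N), fu \<bullet> (N /\<^sub>R norm N)],
             vector [ev \<bullet> (N /\<^sub>R norm N), fv \<bullet> (N /\<^sub>R norm N)]]) =
     ((f \<bullet> f) * (eu \<bullet> N) - (e \<bullet> f) * (ev \<bullet> N) - (f \<bullet> e) * (fu \<bullet> N) + (e \<bullet> e) * (fv \<bullet> N))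
       / ((b * E)\<^sup>2 * norm N)"
    unfolding matrix_inv_2[OF det det0]
    by (simp add: trace_def sum_2 matrix_matrix_mult_def divide_inverse algebra_simps)
  also have "\<dots> = E * ((a\<^sup>2 + b\<^sup>2) * (eu \<bullet> N) - a * (fu \<bullet> N) - a * (ev \<bullet> N) + fv \<bullet> N)
       / ((b * E)\<^sup>2 * (b * E))"
    unfolding F G nN E_def[symmetric] by (simp add: algebra_simps)
  also have "\<dots> = - 4 / sqrt 3"
    unfolding S using b E by (simp add: field_simps)
  finally show ?thesis by simp
qed

section \<open>Left logarithmic derivatives\<close>

text \<open>The pull-back \<open>p\<^sup>-\<^sup>1 dp\<close> of the Maurer-Cartan form. It is imaginary when \<open>p\<close> has values in \<open>S\<^sup>3\<close>, so
  that \<open>snd\<close> then loses nothing.\<close>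

definition left_log :: "(complex \<Rightarrow> quat) \<Rightarrow> complex \<Rightarrow> complex \<Rightarrow> real^3" where
  "left_log p z w = snd (qinv (p z) \<odot> frechet_derivative p (at z) w)"

context
  fixes S :: "complex set" and p :: "complex \<Rightarrow> quat"
  assumes S: "open S" and smooth: "smooth_on p S" and S3: "p ` S \<subseteq> S3"
begin

lemma derivative_tangent_S3:
  assumes "z \<in> S"
  shows "p z \<bullet> frechet_derivative p (at z) w = 0"
proof -
  let ?D = "frechet_derivative p (at z)"
  have D: "(p has_derivative ?D) (at z)"
    using smooth_on_differentiable[OF smooth assms] .
  have "((\<lambda>x. p x \<bullet> p x) has_derivative (\<lambda>h. p z \<bullet> ?D h + ?D h \<bullet> p z)) (at z)"
    by (rule has_derivative_inner[OF D D])
  moreover have "((\<lambda>x. p x \<bullet> p x) has_derivative (\<lambda>h. 0)) (at z)"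
    by (rule has_derivative_cong_open[OF S assms _ has_derivative_const[of 1]])
      (metis S3 S3_inner image_subset_iff)
  ultimately have "(\<lambda>h. p z \<bullet> ?D h + ?D h \<bullet> p z) = (\<lambda>h. 0)"
    by (rule has_derivative_unique)
  then have "p z \<bullet> ?D w + ?D w \<bullet> p z = 0"
    by metis
  then show ?thesis
    by (simp add: inner_commute)
qed

lemma left_log_eq: "z \<in> S \<Longrightarrow> left_log p z w = snd (qcnj (p z) \<odot> frechet_derivative p (at z) w)"
  using S3 by (simp add: left_log_def qinv_S3 image_subset_iff del: mem_sphere_0)

lemma derivative_eq_left_log: "z \<in> S \<Longrightarrow> frechet_derivative p (at z) w = p z \<odot> (0, left_log p z w)"
  unfolding left_log_def by (rule S3_tangent_eq) (use S3 derivative_tangent_S3 in auto)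

lemma smooth_left_log: "smooth_on (\<lambda>z. left_log p z w) S"
proof (rule smooth_on_cong[OF S])
  show "smooth_on (\<lambda>z. snd (qcnj (p z) \<odot> frechet_derivative p (at z) w)) S"
    by (intro smooth_on_bounded_linear[OF S bounded_linear_snd]
        smooth_on_bounded_bilinear[OF S bounded_bilinear_qmul]
        smooth_on_bounded_linear[OF S bounded_linear_qcnj] smooth smooth_on_derivative[OF smooth])
qed (simp add: left_log_eq)

text \<open>The terms with second derivatives of \<open>p\<close> cancel by symmetry. What remains of the product rule is the
  commutator of two imaginary quaternions, which is twice their cross product.\<close>

lemma maurer_cartan:
  assumes z: "z \<in> S"
  shows "frechet_derivative (\<lambda>z. left_log p z w) (at z) v - frechet_derivative (\<lambda>z. left_log p z v) (at z) w =
    2 *\<^sub>R cross3 (left_log p z w) (left_log p z v)"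
proof -
  let ?D = "\<lambda>z. frechet_derivative p (at z)"
  define DD where "DD w = frechet_derivative (\<lambda>z. ?D z w) (at z)" for w
  have D: "(p has_derivative ?D x) (at x)" if "x \<in> S" for x
    using smooth_on_differentiable[OF smooth that] .
  have DD: "((\<lambda>x. ?D x w) has_derivative DD w) (at z)" for w
    unfolding DD_def by (rule smooth_on_differentiable[OF smooth_on_derivative[OF smooth] z])
  have der: "frechet_derivative (\<lambda>z. left_log p z w) (at z) =
      (\<lambda>v. snd (qcnj (p z) \<odot> DD w v + qcnj (?D z v) \<odot> ?D z w))" for w
  proof (rule frechet_derivative_eqI, rule has_derivative_cong_open[OF S z])
    show "((\<lambda>z. snd (qcnj (p z) \<odot> ?D z w)) has_derivative
        (\<lambda>v. snd (qcnj (p z) \<odot> DD w v + qcnj (?D z v) \<odot> ?D z w))) (at z)"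
      by (intro bounded_linear.has_derivative[OF bounded_linear_snd]
          bounded_bilinear.FDERIV[OF bounded_bilinear_qmul]
          bounded_linear.has_derivative[OF bounded_linear_qcnj] D[OF z] DD)
  qed (simp add: left_log_eq)
  have "DD w v = DD v w"
    by (rule symmetric_second_derivative[OF S z D DD DD])
  then have "frechet_derivative (\<lambda>z. left_log p z w) (at z) v - frechet_derivative (\<lambda>z. left_log p z v) (at z) w =
     snd (qcnj (?D z v) \<odot> ?D z w - qcnj (?D z w) \<odot> ?D z v)"
    unfolding der by simp
  also have "qcnj (?D z v) \<odot> ?D z w - qcnj (?D z w) \<odot> ?D z v =
     qcnj (0, left_log p z v) \<odot> (0, left_log p z w) - qcnj (0, left_log p z w) \<odot> (0, left_log p z v)"
  proof -
    have "p z \<in> S3" using S3 z by auto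
    then have "qcnj (p z) \<odot> (p z \<odot> X) = X" for X
      using qinv_qmul_cancel qinv_S3 by metis
    then show ?thesis
      unfolding derivative_eq_left_log[OF z] qcnj_qmul qmul_assoc by simp
  qed
  also have "snd \<dots> = 2 *\<^sub>R cross3 (left_log p z w) (left_log p z v)"
    by (simp add: qmul_def qcnj_def cross_minus_left cross_skew[of "left_log p z v" "left_log p z w"] flip: scaleR_2)
  finally show ?thesis .
qed

end

section \<open>Almost complex surfaces in one coordinate patch\<close>

lemma linear_complex_split:
  fixes L :: "complex \<Rightarrow> 'b::real_vector"
  assumes "linear L"
  shows "L w = Re w *\<^sub>R L 1 + Im w *\<^sub>R L \<i>"
proof -
  have "w = Re w *\<^sub>R 1 + Im w *\<^sub>R \<i>"
    by (simp add: complex_eq_iff)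
  then show ?thesis
    using assms by (metis linear_add linear_scale)
qed

text \<open>The coordinate expression \<open>\<Phi>\<close> of an almost complex surface in a chart with image \<open>S\<close>.\<close>

locale almost_complex_patch =
  fixes S :: "complex set" and \<Phi> :: "complex \<Rightarrow> quat \<times> quat"
  assumes S: "open S" and smooth: "smooth_on \<Phi> S" and S3: "\<Phi> ` S \<subseteq> S3 \<times> S3"
    and inj: "z \<in> S \<Longrightarrow> inj (frechet_derivative \<Phi> (at z))"
    and J_inv: "z \<in> S \<Longrightarrow>
      nk_J (\<Phi> z) ` range (frechet_derivative \<Phi> (at z)) \<subseteq> range (frechet_derivative \<Phi> (at z))"
begin

abbreviation p where "p \<equiv> \<lambda>z. fst (\<Phi> z)"
abbreviation q where "q \<equiv> \<lambda>z. snd (\<Phi> z)"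
abbreviation D where "D z \<equiv> frechet_derivative \<Phi> (at z)"

definition \<omega> where "\<omega> z w = body_diff (\<Phi> z) (D z w)"

lemma \<Phi>_S3: "z \<in> S \<Longrightarrow> \<Phi> z \<in> S3 \<times> S3"
  using S3 by blast

lemma pq: "smooth_on p S" "p ` S \<subseteq> S3" "smooth_on q S" "q ` S \<subseteq> S3"
  using S3 smooth_on_bounded_linear[OF S bounded_linear_fst smooth]
    smooth_on_bounded_linear[OF S bounded_linear_snd smooth] by auto

lemma linear_D: "z \<in> S \<Longrightarrow> linear (D z)"
  using smooth_on_differentiable[OF smooth] has_derivative_linear by blast

lemma D_pq:
  assumes "z \<in> S"
  shows "frechet_derivative p (at z) w = fst (D z w)" "frechet_derivative q (at z) w = snd (D z w)"
proof -
  have D: "(\<Phi> has_derivative D z) (at z)"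
    using smooth_on_differentiable[OF smooth assms] .
  show "frechet_derivative p (at z) w = fst (D z w)" "frechet_derivative q (at z) w = snd (D z w)"
    using frechet_derivative_eqI[OF has_derivative_fst[OF D]]
      frechet_derivative_eqI[OF has_derivative_snd[OF D]] by auto
qed

lemma D_frame: "z \<in> S \<Longrightarrow> D z w = frame (\<Phi> z) (left_log p z w) (left_log q z w)"
  using derivative_eq_left_log[OF S pq(1,2), of z w] derivative_eq_left_log[OF S pq(3,4), of z w]
  by (simp add: frame_def D_pq prod_eq_iff)

lemma \<omega>_eq: "z \<in> S \<Longrightarrow> \<omega> z w = left_log q z w - left_log p z w"
  by (simp add: \<omega>_def body_diff_def left_log_def D_pq)

lemma smooth_\<omega>: "smooth_on (\<lambda>z. \<omega> z w) S"
  by (rule smooth_on_cong[OF S _ smooth_on_diff[OF S smooth_left_log[OF S pq(3,4)] smooth_left_log[OF S pq(1,2)]]])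
    (simp add: \<omega>_eq)

lemma linear_\<omega>: "z \<in> S \<Longrightarrow> linear (\<omega> z)"
  by (rule linearI)
    (simp_all add: \<omega>_def body_diff_def linear_add[OF linear_D] linear_scale[OF linear_D]
      qmul_add_right qmul_scaleR_right scaleR_diff_right)

lemma D_nonzero: "z \<in> S \<Longrightarrow> w \<noteq> 0 \<Longrightarrow> D z w \<noteq> 0"
  using inj linear_D linear_0 by (metis injD)

text \<open>The vectors \<open>\<phi>\<^sub>u\<close> and \<open>J\<phi>\<^sub>u\<close> are linearly independent, because \<open>J\<^sup>2 = -1\<close> excludes real
  eigenvalues; as the tangent plane is \<open>J\<close>-invariant, they span it.\<close>

lemma D_i_decomposition:
  assumes z: "z \<in> S"
  obtains a b where "D z \<i> = a *\<^sub>R D z 1 + b *\<^sub>R nk_J (\<Phi> z) (D z 1)"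
proof -
  obtain w where w: "nk_J (\<Phi> z) (D z 1) = D z w"
    using J_inv[OF z] by blast
  then have eq: "nk_J (\<Phi> z) (D z 1) = Re w *\<^sub>R D z 1 + Im w *\<^sub>R D z \<i>"
    using linear_complex_split[OF linear_D[OF z], of w] by simp
  have lJ: "linear (nk_J (\<Phi> z))" by (rule linear_nk_J)
  have "Im w \<noteq> 0"
  proof
    assume "Im w = 0"
    then have J: "nk_J (\<Phi> z) (D z 1) = Re w *\<^sub>R D z 1"
      using eq by simp
    then have JJ: "nk_J (\<Phi> z) (nk_J (\<Phi> z) (D z 1)) = (Re w * Re w) *\<^sub>R D z 1"
      by (simp add: linear_scale[OF lJ])
    have "(Re w * Re w + 1) *\<^sub>R D z 1 = 0"
      using nk_J_nk_J[OF \<Phi>_S3[OF z], of "D z 1"] by (simp add: scaleR_add_left flip: JJ)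
    moreover have "Re w * Re w + 1 \<noteq> 0"
      by (smt (verit) zero_le_square)
    ultimately show False
      using D_nonzero[OF z, of 1] by simp
  qed
  then have "D z \<i> = (1 / Im w) *\<^sub>R (nk_J (\<Phi> z) (D z 1) - Re w *\<^sub>R D z 1)"
    unfolding eq by simp
  also have "\<dots> = (- Re w / Im w) *\<^sub>R D z 1 + (1 / Im w) *\<^sub>R nk_J (\<Phi> z) (D z 1)"
    by (simp add: scaleR_diff_right)
  finally show ?thesis using that by blast
qed

lemma cross_left_log:
  assumes z: "z \<in> S"
  shows "cross3 (left_log q z 1) (left_log q z \<i>) = cross3 (left_log p z 1) (left_log p z \<i>)"
    "cross3 (\<omega> z 1) (\<omega> z \<i>) = cross3 (left_log p z 1) (left_log p z \<i>)"
proof -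
  obtain a b where "D z \<i> = a *\<^sub>R D z 1 + b *\<^sub>R nk_J (\<Phi> z) (D z 1)"
    using D_i_decomposition[OF z] .
  from cross_frame[OF \<Phi>_S3[OF z] this[unfolded D_frame[OF z]]]
  show "cross3 (left_log q z 1) (left_log q z \<i>) = cross3 (left_log p z 1) (left_log p z \<i>)"
    "cross3 (\<omega> z 1) (\<omega> z \<i>) = cross3 (left_log p z 1) (left_log p z \<i>)"
    unfolding \<omega>_eq[OF z] .
qed

lemma left_log_derivative:
  "z \<in> S \<Longrightarrow> ((\<lambda>z. left_log p z w) has_derivative frechet_derivative (\<lambda>z. left_log p z w) (at z)) (at z)"
  "z \<in> S \<Longrightarrow> ((\<lambda>z. left_log q z w) has_derivative frechet_derivative (\<lambda>z. left_log q z w) (at z)) (at z)"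
  using smooth_on_differentiable[OF smooth_left_log[OF S pq(1,2)]]
    smooth_on_differentiable[OF smooth_left_log[OF S pq(3,4)]] by auto

lemma \<omega>_derivative:
  "z \<in> S \<Longrightarrow> ((\<lambda>z. \<omega> z w) has_derivative frechet_derivative (\<lambda>z. \<omega> z w) (at z)) (at z)"
  using smooth_on_differentiable[OF smooth_\<omega>] .

lemma frechet_\<omega>:
  assumes z: "z \<in> S"
  shows "frechet_derivative (\<lambda>z. \<omega> z w) (at z) v =
    frechet_derivative (\<lambda>z. left_log q z w) (at z) v - frechet_derivative (\<lambda>z. left_log p z w) (at z) v"
proof -
  have "((\<lambda>z. \<omega> z w) has_derivative (\<lambda>v. frechet_derivative (\<lambda>z. left_log q z w) (at z) v
     - frechet_derivative (\<lambda>z. left_log p z w) (at z) v)) (at z)"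
    by (rule has_derivative_cong_open[OF S z _ has_derivative_diff[OF left_log_derivative(2,1)[OF z]]])
      (simp add: \<omega>_eq)
  from frechet_derivative_eqI[OF this] show ?thesis by metis
qed

text \<open>The exterior derivatives of the two left logarithmic derivatives have the same right-hand side in
  the Maurer-Cartan equation, by \<open>cross_left_log\<close>.\<close>

lemma \<omega>_closed:
  assumes z: "z \<in> S"
  shows "frechet_derivative (\<lambda>z. \<omega> z 1) (at z) \<i> = frechet_derivative (\<lambda>z. \<omega> z \<i>) (at z) 1"
proof -
  let ?d = "\<lambda>f w v. frechet_derivative (\<lambda>z. left_log f z w) (at z) v"
  have "?d p 1 \<i> - ?d p \<i> 1 = ?d q 1 \<i> - ?d q \<i> 1"
    using maurer_cartan[OF S pq(1,2) z] maurer_cartan[OF S pq(3,4) z] cross_left_log(1)[OF z] by simp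
  then show ?thesis
    unfolding frechet_\<omega>[OF z] by (simp add: algebra_simps)
qed

lemma local_primitive:
  assumes "ball z0 e \<subseteq> S"
  obtains F where "\<And>z. z \<in> ball z0 e \<Longrightarrow> (F has_derivative \<omega> z) (at z)"
proof -
  have cont: "continuous_on (ball z0 e) (\<lambda>z. frechet_derivative (\<lambda>z. \<omega> z v) (at z) w)" for v w
    by (rule continuous_on_subset[OF smooth_on_continuous[OF smooth_on_derivative[OF smooth_\<omega>]] assms])
  obtain F where F: "\<And>z. z \<in> ball z0 e \<Longrightarrow>
      (F has_derivative (\<lambda>w. Re w *\<^sub>R \<omega> z 1 + Im w *\<^sub>R \<omega> z \<i>)) (at z)"
    by (rule closed_form_primitive[OF refl \<omega>_derivative \<omega>_derivative cont cont \<omega>_closed])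
      (use assms in auto)
  have "(\<lambda>w. Re w *\<^sub>R \<omega> z 1 + Im w *\<^sub>R \<omega> z \<i>) = \<omega> z" if "z \<in> ball z0 e" for z
    by (rule ext, rule linear_complex_split[symmetric], rule linear_\<omega>) (use that assms in auto)
  then have "(F has_derivative \<omega> z) (at z)" if "z \<in> ball z0 e" for z
    using F[OF that] that by simp
  then show ?thesis
    by (rule that)
qed

text \<open>When \<open>\<phi>\<^sub>v = J\<phi>\<^sub>u\<close>, the \<open>q\<close>-components can be eliminated in favour of \<open>\<alpha> = p\<^sup>-\<^sup>1 p\<^sub>u\<close> and
  \<open>\<beta> = p\<^sup>-\<^sup>1 p\<^sub>v\<close>; the right-hand sides are \<open>\<alpha>\<close>-tilde and \<open>\<beta>\<close>-tilde.\<close>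

lemma \<omega>_isothermal:
  assumes z: "z \<in> S" and J: "nk_J (\<Phi> z) (D z 1) = D z \<i>"
  shows "\<omega> z 1 = (- 1 / 2) *\<^sub>R left_log p z 1 + (sqrt 3 / 2) *\<^sub>R left_log p z \<i>"
    "\<omega> z \<i> = (- sqrt 3 / 2) *\<^sub>R left_log p z 1 - (1 / 2) *\<^sub>R left_log p z \<i>"
proof -
  define s where "s = sqrt 3"
  have s: "s * (s * x) = 3 * x" "s \<noteq> 0" for x :: real
    by (simp_all add: s_def flip: mult.assoc)
  have p: "left_log p z \<i> = (1 / s) *\<^sub>R (2 *\<^sub>R left_log q z 1 - left_log p z 1)"
    and q: "left_log q z \<i> = (1 / s) *\<^sub>R (left_log q z 1 - 2 *\<^sub>R left_log p z 1)"
    using J unfolding D_frame[OF z] nk_J_frame[OF \<Phi>_S3[OF z]] frame_inject[OF \<Phi>_S3[OF z]] s_def by auto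
  show "\<omega> z 1 = (- 1 / 2) *\<^sub>R left_log p z 1 + (sqrt 3 / 2) *\<^sub>R left_log p z \<i>"
    "\<omega> z \<i> = (- sqrt 3 / 2) *\<^sub>R left_log p z 1 - (1 / 2) *\<^sub>R left_log p z \<i>"
    unfolding \<omega>_eq[OF z] p q s_def[symmetric] using s
    by (simp_all add: vec_eq_iff field_simps)
qed

end

text \<open>The assumption is the vanishing of \<open>Lambda_dz2\<close>, written in terms of the coordinate expression.\<close>

locale null_patch = almost_complex_patch +
  assumes Lambda: "z \<in> S \<Longrightarrow>
    (let X = D z w; Z = ((1/2) *\<^sub>R X, - ((1/2) *\<^sub>R nk_J (\<Phi> z) X)) in gC (\<Phi> z) (PC (\<Phi> z) Z) Z) = 0"
begin

lemma \<omega>_norm: "z \<in> S \<Longrightarrow> \<omega> z w \<bullet> \<omega> z w = 1/2 * nk_g (\<Phi> z) (D z w) (D z w)"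
  unfolding \<omega>_def using norm_body_diff[OF \<Phi>_S3 D_frame] Lambda by (simp only: Let_def)

lemma \<omega>_inner:
  assumes z: "z \<in> S"
  shows "\<omega> z w \<bullet> \<omega> z w' = 1/2 * nk_g (\<Phi> z) (D z w) (D z w')"
proof -
  let ?g = "nk_g (\<Phi> z)"
  have "\<omega> z (w + w') \<bullet> \<omega> z (w + w') = \<omega> z w \<bullet> \<omega> z w + \<omega> z w' \<bullet> \<omega> z w' + 2 * (\<omega> z w \<bullet> \<omega> z w')"
    by (simp add: linear_add[OF linear_\<omega>[OF z]] inner_add_left inner_add_right inner_commute)
  moreover have "?g (D z (w + w')) (D z (w + w')) =
      ?g (D z w) (D z w) + ?g (D z w') (D z w') + 2 * ?g (D z w) (D z w')"
    unfolding linear_add[OF linear_D[OF z]] by (rule nk_g_polarization)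
  ultimately show ?thesis
    unfolding \<omega>_norm[OF z] by simp
qed

lemma inj_\<omega>: "z \<in> S \<Longrightarrow> inj (\<omega> z)"
  unfolding linear_injective_0[OF linear_\<omega>]
proof (intro allI impI, rule ccontr)
  fix w assume z: "z \<in> S" and 0: "\<omega> z w = 0" and "w \<noteq> 0"
  then have "D z w \<noteq> 0"
    using D_nonzero by blast
  then have "nk_g (\<Phi> z) (D z w) (D z w) > 0"
    by (simp add: nk_g_def add_pos_nonneg)
  then show False
    using \<omega>_norm[OF z, of w] 0 by simp
qed

text \<open>The form \<open>\<omega> \<circ> J\<close>. It is a multiple of the sum of the two left logarithmic derivatives, just as
  \<open>\<omega>\<close> is their difference, so its exterior derivative is known as well.\<close>

definition \<kappa> where "\<kappa> z w = body_diff (\<Phi> z) (nk_J (\<Phi> z) (D z w))"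

lemma \<kappa>_eq: "z \<in> S \<Longrightarrow> \<kappa> z w = - ((1 / sqrt 3) *\<^sub>R (left_log q z w + left_log p z w))"
  by (simp add: \<kappa>_def D_frame nk_J_frame[OF \<Phi>_S3] body_diff_frame[OF \<Phi>_S3] scaleR_2
      flip: scaleR_minus_right scaleR_diff_right)

lemma \<omega>_\<kappa>_i:
  assumes z: "z \<in> S" and ab: "D z \<i> = a *\<^sub>R D z 1 + b *\<^sub>R nk_J (\<Phi> z) (D z 1)"
  shows "\<omega> z \<i> = a *\<^sub>R \<omega> z 1 + b *\<^sub>R \<kappa> z 1" "\<kappa> z \<i> = a *\<^sub>R \<kappa> z 1 - b *\<^sub>R \<omega> z 1"
proof -
  have lin: "linear (body_diff (\<Phi> z))"
    by (rule linearI) (simp_all add: body_diff_def qmul_add_right qmul_scaleR_right scaleR_diff_right)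
  show "\<omega> z \<i> = a *\<^sub>R \<omega> z 1 + b *\<^sub>R \<kappa> z 1"
    unfolding \<omega>_def \<kappa>_def ab by (simp add: linear_add[OF lin] linear_scale[OF lin])
  have "nk_J (\<Phi> z) (D z \<i>) = a *\<^sub>R nk_J (\<Phi> z) (D z 1) - b *\<^sub>R D z 1"
    unfolding ab by (simp add: linear_add[OF linear_nk_J] linear_scale[OF linear_nk_J] nk_J_nk_J[OF \<Phi>_S3[OF z]])
  then show "\<kappa> z \<i> = a *\<^sub>R \<kappa> z 1 - b *\<^sub>R \<omega> z 1"
    unfolding \<omega>_def \<kappa>_def by (simp add: linear_diff[OF lin] linear_scale[OF lin])
qed

text \<open>\<open>J\<close> preserves the tangent plane, so \<open>\<kappa>\<close> has values in the image of \<open>\<omega>\<close>.\<close>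

lemma \<kappa>_normal:
  assumes z: "z \<in> S"
  shows "\<kappa> z 1 \<bullet> cross3 (\<omega> z 1) (\<omega> z \<i>) = 0" "\<kappa> z \<i> \<bullet> cross3 (\<omega> z 1) (\<omega> z \<i>) = 0"
proof -
  obtain a b where "D z \<i> = a *\<^sub>R D z 1 + b *\<^sub>R nk_J (\<Phi> z) (D z 1)"
    using D_i_decomposition[OF z] .
  note * = \<omega>_\<kappa>_i[OF z this]
  show "\<kappa> z 1 \<bullet> cross3 (\<omega> z 1) (\<omega> z \<i>) = 0" "\<kappa> z \<i> \<bullet> cross3 (\<omega> z 1) (\<omega> z \<i>) = 0"
    unfolding * by (simp_all add: cross3_def inner_vec_def sum_3 algebra_simps)
qed

lemma \<kappa>_derivative:
  assumes z: "z \<in> S"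
  shows "((\<lambda>z. \<kappa> z w) has_derivative (\<lambda>v. - ((1 / sqrt 3) *\<^sub>R
    (frechet_derivative (\<lambda>z. left_log q z w) (at z) v + frechet_derivative (\<lambda>z. left_log p z w) (at z) v)))) (at z)"
  by (rule has_derivative_cong_open[OF S z])
    (auto simp: \<kappa>_eq intro!: has_derivative_minus has_derivative_scaleR_right has_derivative_add left_log_derivative z)

text \<open>\<open>J\<close> is a skew isometry of \<open>g\<close>, and \<open>\<omega>\<close> is an isometry up to scale. Hence \<open>\<omega>\<close> and \<open>\<kappa>\<close>
  take a tangent vector to orthogonal vectors of equal length, as \<open>mean_curvature_algebra\<close> demands.
  The sign condition is the orientation of the coordinates: it says that \<open>b > 0\<close>.\<close>

lemma mean_curvature_\<omega>:
  assumes z: "z \<in> S" and pos: "nk_g (\<Phi> z) (nk_J (\<Phi> z) (D z 1)) (D z \<i>) > 0"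
  defines "N \<equiv> cross3 (\<omega> z 1) (\<omega> z \<i>)"
    and "d \<equiv> \<lambda>v w. frechet_derivative (\<lambda>z. \<omega> z w) (at z) v"
  shows "1/2 * trace (matrix_inv (vector [vector [\<omega> z 1 \<bullet> \<omega> z 1, \<omega> z 1 \<bullet> \<omega> z \<i>],
             vector [\<omega> z \<i> \<bullet> \<omega> z 1, \<omega> z \<i> \<bullet> \<omega> z \<i>]] :: real^2^2) **
     vector [vector [d 1 1 \<bullet> (N /\<^sub>R norm N), d 1 \<i> \<bullet> (N /\<^sub>R norm N)],
             vector [d \<i> 1 \<bullet> (N /\<^sub>R norm N), d \<i> \<i> \<bullet> (N /\<^sub>R norm N)]]) = - 2 / sqrt 3"
proof -
  define X where "X = D z 1"
  have JJ: "nk_J (\<Phi> z) (nk_J (\<Phi> z) X) = - X"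
    by (rule nk_J_nk_J[OF \<Phi>_S3[OF z]])
  obtain a b where ab: "D z \<i> = a *\<^sub>R D z 1 + b *\<^sub>R nk_J (\<Phi> z) (D z 1)"
    using D_i_decomposition[OF z] .
  note fk = \<omega>_\<kappa>_i[OF z ab]
  obtain w where w: "nk_J (\<Phi> z) (D z 1) = D z w"
    using J_inv[OF z] by blast
  then have \<kappa>1: "\<kappa> z 1 = \<omega> z w"
    by (simp add: \<kappa>_def \<omega>_def)
  have gJ: "nk_g (\<Phi> z) X (nk_J (\<Phi> z) X) = 0" "nk_g (\<Phi> z) (nk_J (\<Phi> z) X) X = 0"
    "nk_g (\<Phi> z) (nk_J (\<Phi> z) X) (nk_J (\<Phi> z) X) = nk_g (\<Phi> z) X X"
    by (simp_all add: nk_g_def JJ inner_commute)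
  have "X \<noteq> 0"
    unfolding X_def using D_nonzero[OF z] by simp
  then have gX: "nk_g (\<Phi> z) X X > 0"
    by (simp add: nk_g_def add_pos_nonneg)
  have "nk_g (\<Phi> z) (nk_J (\<Phi> z) X) (D z \<i>) = b * nk_g (\<Phi> z) X X"
  proof -
    have "nk_g (\<Phi> z) Y (a *\<^sub>R X + b *\<^sub>R Z) = a * nk_g (\<Phi> z) Y X + b * nk_g (\<Phi> z) Y Z" for Y Z
      by (simp add: nk_g_def linear_add[OF linear_nk_J] linear_scale[OF linear_nk_J]
          inner_add_right algebra_simps)
    then show ?thesis
      unfolding ab X_def[symmetric] by (simp add: gJ)
  qed
  then have b: "b > 0"
    using pos gX unfolding X_def by (simp add: zero_less_mult_iff)
  have perp: "\<omega> z 1 \<bullet> \<kappa> z 1 = 0" "\<kappa> z 1 \<bullet> \<kappa> z 1 = \<omega> z 1 \<bullet> \<omega> z 1" "\<omega> z 1 \<noteq> 0"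
  proof -
    show "\<omega> z 1 \<bullet> \<kappa> z 1 = 0" "\<kappa> z 1 \<bullet> \<kappa> z 1 = \<omega> z 1 \<bullet> \<omega> z 1"
      unfolding \<kappa>1 \<omega>_inner[OF z] w[symmetric] X_def[symmetric] by (simp_all add: gJ)
    have "\<omega> z 1 \<bullet> \<omega> z 1 > 0"
      unfolding \<omega>_inner[OF z] X_def[symmetric] using gX by simp
    then show "\<omega> z 1 \<noteq> 0" by auto
  qed
  define k where "k v w = - ((1 / sqrt 3) *\<^sub>R
    (frechet_derivative (\<lambda>z. left_log q z w) (at z) v + frechet_derivative (\<lambda>z. left_log p z w) (at z) v))" for v w
  have normal: "k v w \<bullet> N + \<kappa> z w \<bullet> (cross3 (d v 1) (\<omega> z \<i>) + cross3 (\<omega> z 1) (d v \<i>)) = 0"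
    if "w = 1 \<or> w = \<i>" for v w
  proof -
    have bil: "bounded_bilinear cross3"
      using bilinear_cross bilinear_conv_bounded_bilinear by blast
    have "((\<lambda>x. \<kappa> x w \<bullet> cross3 (\<omega> x 1) (\<omega> x \<i>)) has_derivative
       (\<lambda>v. \<kappa> z w \<bullet> (cross3 (\<omega> z 1) (d v \<i>) + cross3 (d v 1) (\<omega> z \<i>))
         + k v w \<bullet> cross3 (\<omega> z 1) (\<omega> z \<i>))) (at z)"
      unfolding d_def k_def
      by (intro has_derivative_inner \<kappa>_derivative[OF z] bounded_bilinear.FDERIV[OF bil]
          \<omega>_derivative[OF z])
    moreover have "((\<lambda>x. \<kappa> x w \<bullet> cross3 (\<omega> x 1) (\<omega> x \<i>)) has_derivative (\<lambda>v. 0)) (at z)"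
      by (rule has_derivative_cong_open[OF S z _ has_derivative_const[of 0]])
        (use \<kappa>_normal that in auto)
    ultimately have "(\<lambda>v. \<kappa> z w \<bullet> (cross3 (\<omega> z 1) (d v \<i>) + cross3 (d v 1) (\<omega> z \<i>))
         + k v w \<bullet> cross3 (\<omega> z 1) (\<omega> z \<i>)) = (\<lambda>v. 0)"
      by (rule has_derivative_unique)
    then show ?thesis
      unfolding N_def by (metis add.commute)
  qed
  let ?dp = "\<lambda>w v. frechet_derivative (\<lambda>z. left_log p z w) (at z) v"
  let ?dq = "\<lambda>w v. frechet_derivative (\<lambda>z. left_log q z w) (at z) v"
  have "k 1 \<i> - k \<i> 1 = (1 / sqrt 3) *\<^sub>R ((?dp 1 \<i> - ?dp \<i> 1) + (?dq 1 \<i> - ?dq \<i> 1))"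
    unfolding k_def by (simp add: scaleR_diff_right scaleR_add_right)
  also have "\<dots> = (1 / sqrt 3) *\<^sub>R (2 *\<^sub>R N + 2 *\<^sub>R N)"
    unfolding maurer_cartan[OF S pq(1,2) z] maurer_cartan[OF S pq(3,4) z] N_def cross_left_log[OF z] ..
  finally have "k 1 \<i> - k \<i> 1 = (1 / sqrt 3) *\<^sub>R (2 *\<^sub>R N + 2 *\<^sub>R N)" .
  then have dk: "k 1 \<i> - k \<i> 1 = (4 / sqrt 3) *\<^sub>R N"
    by (simp flip: scaleR_add_left)
  show ?thesis
    by (rule mean_curvature_algebra[OF fk b perp N_def[THEN meta_eq_to_obj_eq] normal normal dk]) auto
qed

end

section \<open>The potential on the whole surface\<close>

lemma chart_inverse: 
  assumes "is_chart M c"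
  shows "m \<in> cdom c \<Longrightarrow> chart_inv c (snd c m) = m"
    and "z \<in> snd c ` cdom c \<Longrightarrow> snd c (chart_inv c z) = z"
    and "z \<in> snd c ` cdom c \<Longrightarrow> chart_inv c z \<in> cdom c"
    and "m \<in> cdom c \<Longrightarrow> m \<in> M"
    and "open (snd c ` cdom c)"
  using assms openin_imp_subset
  by (auto simp: is_chart_def homeomorphism_def inv_into_into f_inv_into_f)

lemma chart_image_open:
  assumes c: "is_chart M c" and N: "openin (top_of_set M) N" "N \<subseteq> cdom c"
  shows "open (snd c ` N)"
proof -
  have "openin (top_of_set (cdom c)) N"
    using N c openin_imp_subset by (metis openin_subset_trans is_chart_def)
  then have "openin (top_of_set (snd c ` cdom c)) (snd c ` N)"
    using c homeomorphism_imp_open_map unfolding is_chart_def by blast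
  then show ?thesis
    using chart_inverse(5)[OF c] openin_open_trans by blast
qed

lemma chart_inv_image_open:
  assumes c: "is_chart M c" and B: "open B" "B \<subseteq> snd c ` cdom c"
  shows "openin (top_of_set M) (chart_inv c ` B)"
proof -
  have "openin (top_of_set (snd c ` cdom c)) B"
    using B by (simp add: open_subset)
  then have "openin (top_of_set (cdom c)) (chart_inv c ` B)"
    using c homeomorphism_imp_open_map homeomorphism_symD unfolding is_chart_def by blast
  then show ?thesis
    using c openin_trans unfolding is_chart_def by blast
qed

text \<open>The differential of the coordinate change is written out because the lemma is applied to maps into
  different spaces, which share it.\<close>

lemma has_derivative_change_chart:
  fixes f :: "'a::topological_space \<Rightarrow> 'b::real_normed_vector"
  assumes c: "is_chart M c" and d: "is_chart M d" and cd: "compatible c d"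
    and y: "y \<in> cdom c" "y \<in> cdom d"
    and f: "((f \<circ> chart_inv d) has_derivative L) (at (snd d y))"
  shows "((f \<circ> chart_inv c) has_derivative
    (\<lambda>w. L (frechet_derivative (snd d \<circ> chart_inv c) (at (snd c y)) w))) (at (snd c y))"
proof -
  define V where "V = snd c ` (cdom c \<inter> cdom d)"
  have V: "open V" "snd c y \<in> V"
    using y c d by (auto simp: V_def is_chart_def intro!: chart_image_open[OF c])
  let ?\<tau> = "snd d \<circ> chart_inv c"
  have \<tau>: "(?\<tau> has_derivative frechet_derivative ?\<tau> (at (snd c y))) (at (snd c y))"
    using cd V(2) unfolding compatible_def V_def by (intro smooth_on_differentiable) auto
  have "((\<lambda>z. (f \<circ> chart_inv d) (?\<tau> z)) has_derivative
    (\<lambda>w. L (frechet_derivative ?\<tau> (at (snd c y)) w))) (at (snd c y))"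
    by (rule has_derivative_compose[OF \<tau>]) (use f y chart_inverse(1)[OF c] in \<open>simp add: comp_def\<close>)
  then show ?thesis
    by (rule has_derivative_cong_open[OF V, rotated])
      (auto simp: V_def chart_inverse(1)[OF c] chart_inverse(1)[OF d])
qed

lemma atlas_subset_coords: "smooth_surface M A \<Longrightarrow> A \<subseteq> coords M A"
  by (auto simp: smooth_surface_def coords_def)

text \<open>The 1-form \<open>\<omega>\<close> on \<open>M\<close>, evaluated on the tangent vector with components \<open>w\<close> in the chart \<open>c\<close>.\<close>

definition body_form :: "('a \<Rightarrow> quat \<times> quat) \<Rightarrow> 'a chart \<Rightarrow> 'a \<Rightarrow> complex \<Rightarrow> real^3" where
  "body_form \<phi> c m w = body_diff (\<phi> m) (diff c \<phi> m w)"

context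
  fixes M :: "'a::{t2_space,second_countable_topology} set"
    and A :: "'a chart set" and \<phi> :: "'a \<Rightarrow> quat \<times> quat"
  assumes surface: "almost_complex_surface M A \<phi>"
begin

lemma coords_chart: "c \<in> coords M A \<Longrightarrow> is_chart M c"
  by (simp add: coords_def)

lemma atlas_coords: "c \<in> A \<Longrightarrow> c \<in> coords M A"
  using surface atlas_subset_coords unfolding almost_complex_surface_def by blast

lemma coords_patch:
  assumes c: "c \<in> coords M A"
  shows "almost_complex_patch (snd c ` cdom c) (\<phi> \<circ> chart_inv c)"
proof
  note ch = chart_inverse[OF coords_chart[OF c]]
  show "open (snd c ` cdom c)"
    by (rule ch(5))
  show "smooth_on (\<phi> \<circ> chart_inv c) (snd c ` cdom c)"
    using surface c unfolding almost_complex_surface_def immersion_def smooth_map_def by blast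
  show "(\<phi> \<circ> chart_inv c) ` snd c ` cdom c \<subseteq> S3 \<times> S3"
    using surface ch(1,4) unfolding almost_complex_surface_def by fastforce
  fix z assume "z \<in> snd c ` cdom c"
  then obtain m where m: "m \<in> cdom c" "z = snd c m" by blast
  then have D: "frechet_derivative (\<phi> \<circ> chart_inv c) (at z) = diff c \<phi> m" "(\<phi> \<circ> chart_inv c) z = \<phi> m"
    by (auto simp: diff_def ch(1))
  show "inj (frechet_derivative (\<phi> \<circ> chart_inv c) (at z))"
    using surface c m unfolding D almost_complex_surface_def immersion_def by blast
  show "nk_J ((\<phi> \<circ> chart_inv c) z) ` range (frechet_derivative (\<phi> \<circ> chart_inv c) (at z))
      \<subseteq> range (frechet_derivative (\<phi> \<circ> chart_inv c) (at z))"
    using surface c m unfolding D almost_complex_surface_def by blast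
qed

lemma patch_\<omega>:
  assumes c: "c \<in> coords M A" and m: "m \<in> cdom c"
  shows "almost_complex_patch.\<omega> (\<phi> \<circ> chart_inv c) (snd c m) = body_form \<phi> c m"
  using chart_inverse(1)[OF coords_chart[OF c] m]
  by (simp add: fun_eq_iff almost_complex_patch.\<omega>_def[OF coords_patch[OF c]] body_form_def diff_def)

text \<open>Being a primitive of \<open>\<omega>\<close> does not depend on the chart, since both sides are transformed by the same
  differential of the coordinate change. The chart \<open>d\<close> belongs to \<open>A\<close> because \<open>coords\<close> asks for
  smooth compatibility with the charts of \<open>A\<close> only.\<close>

lemma body_form_change_chart:
  assumes c: "c \<in> coords M A" and d: "d \<in> A" and y: "y \<in> cdom c" "y \<in> cdom d"
    and F: "((F \<circ> chart_inv d) has_derivative body_form \<phi> d y) (at (snd d y))"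
  shows "((F \<circ> chart_inv c) has_derivative body_form \<phi> c y) (at (snd c y))"
proof -
  have cd: "compatible c d"
    using c d by (simp add: coords_def)
  note change = has_derivative_change_chart[OF coords_chart[OF c] coords_chart[OF atlas_coords[OF d]] cd y]
  have "((\<phi> \<circ> chart_inv d) has_derivative diff d \<phi> y) (at (snd d y))"
    unfolding diff_def using y(2)
    by (intro smooth_on_differentiable[OF almost_complex_patch.smooth[OF coords_patch[OF atlas_coords[OF d]]]]) auto
  from frechet_derivative_eqI[OF change[OF this]]
  have "diff c \<phi> y = (\<lambda>w. diff d \<phi> y (frechet_derivative (snd d \<circ> chart_inv c) (at (snd c y)) w))"
    by (simp add: diff_def)
  then have "body_form \<phi> c y = (\<lambda>w. body_form \<phi> d y (frechet_derivative (snd d \<circ> chart_inv c) (at (snd c y)) w))"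
    by (simp add: body_form_def fun_eq_iff)
  then show ?thesis
    using change[OF F] by simp
qed

lemma local_potential:
  assumes d: "d \<in> A" and m: "m \<in> cdom d"
  shows "\<exists>W F. openin (top_of_set M) W \<and> m \<in> W \<and> W \<subseteq> cdom d \<and> path_connected W \<and>
    (\<forall>y\<in>W. ((F \<circ> chart_inv d) has_derivative body_form \<phi> d y) (at (snd d y)))"
proof -
  have dc: "d \<in> coords M A"
    using atlas_coords[OF d] .
  note ch = chart_inverse[OF coords_chart[OF dc]]
  obtain e where e: "e > 0" "ball (snd d m) e \<subseteq> snd d ` cdom d"
    using ch(5) m open_contains_ball by (metis imageI)
  define B where "B = ball (snd d m) e"
  obtain F where F: "\<And>z. z \<in> B \<Longrightarrow>
      (F has_derivative almost_complex_patch.\<omega> (\<phi> \<circ> chart_inv d) z) (at z)"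
    using almost_complex_patch.local_primitive[OF coords_patch[OF dc] e(2)] unfolding B_def by blast
  define W where "W = chart_inv d ` B"
  have B: "open B" "B \<subseteq> snd d ` cdom d"
    using e by (auto simp: B_def)
  have "openin (top_of_set M) W"
    unfolding W_def by (rule chart_inv_image_open[OF coords_chart[OF dc] B])
  moreover have "m \<in> W"
    unfolding W_def by (rule image_eqI[of _ _ "snd d m"]) (use ch(1) m e in \<open>auto simp: B_def\<close>)
  moreover have "W \<subseteq> cdom d"
    using B ch(3) by (auto simp: W_def)
  moreover have "path_connected W"
    unfolding W_def
  proof (rule path_connected_continuous_image)
    show "continuous_on B (chart_inv d)"
      using coords_chart[OF dc] B(2) unfolding is_chart_def homeomorphism_def
      by (meson continuous_on_subset)
    show "path_connected B"
      by (simp add: B_def convex_imp_path_connected)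
  qed
  moreover have "((F \<circ> snd d \<circ> chart_inv d) has_derivative body_form \<phi> d y) (at (snd d y))"
    if "y \<in> W" for y
  proof -
    have y: "y \<in> cdom d" "snd d y \<in> B"
      using that B ch(2,3) by (auto simp: W_def subset_iff)
    show ?thesis
      by (rule has_derivative_cong_open[OF B(1) y(2)])
        (use F[OF y(2)] ch(2) B(2) in \<open>auto simp: patch_\<omega>[OF dc y(1)]\<close>)
  qed
  ultimately show ?thesis by blast
qed

text \<open>Seen in the chart \<open>d\<close>, both functions have the differential \<open>\<omega>\<close>.\<close>

lemma potential_difference_locally_constant:
  assumes d: "d \<in> A" "d' \<in> A"
    and W: "openin (top_of_set M) W" "W \<subseteq> cdom d"
      "\<And>y. y \<in> W \<Longrightarrow> ((F \<circ> chart_inv d) has_derivative body_form \<phi> d y) (at (snd d y))"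
    and W': "openin (top_of_set M) W'" "W' \<subseteq> cdom d'"
      "\<And>y. y \<in> W' \<Longrightarrow> ((F' \<circ> chart_inv d') has_derivative body_form \<phi> d' y) (at (snd d' y))"
    and x: "x \<in> W" "x \<in> W'"
  shows "\<forall>\<^sub>F y in at x within M. F y - F' y = F x - F' x"
proof -
  have dc: "d \<in> coords M A"
    using atlas_coords[OF d(1)] .
  note ch = chart_inverse[OF coords_chart[OF dc]]
  have "open (snd d ` (W \<inter> W'))"
    using W W' by (intro chart_image_open[OF coords_chart[OF dc]]) auto
  then obtain e where e: "e > 0" "ball (snd d x) e \<subseteq> snd d ` (W \<inter> W')"
    using x open_contains_ball by (metis IntI imageI)
  define B where "B = ball (snd d x) e"
  have "\<exists>k. \<forall>z\<in>B. (F \<circ> chart_inv d) z - (F' \<circ> chart_inv d) z = k"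
  proof (rule has_derivative_zero_constant)
    fix z assume "z \<in> B"
    then obtain y where y: "y \<in> W" "y \<in> W'" "z = snd d y"
      using e(2) by (auto simp: B_def)
    have "((F' \<circ> chart_inv d) has_derivative body_form \<phi> d y) (at (snd d y))"
      using y W W' by (intro body_form_change_chart[OF dc d(2)]) auto
    from has_derivative_at_withinI[OF has_derivative_diff[OF W(3)[OF y(1)] this], of B]
    show "((\<lambda>z. (F \<circ> chart_inv d) z - (F' \<circ> chart_inv d) z) has_derivative (\<lambda>h. 0)) (at z within B)"
      by (simp only: y(3) diff_self)
  qed (simp add: B_def)
  then obtain k where k: "\<And>z. z \<in> B \<Longrightarrow> F (chart_inv d z) - F' (chart_inv d z) = k"
    by auto
  have B: "open B" "B \<subseteq> snd d ` cdom d"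
    using e W(2) by (auto simp: B_def)
  then have "openin (top_of_set M) (chart_inv d ` B)"
    by (rule chart_inv_image_open[OF coords_chart[OF dc]])
  then obtain O' where O': "open O'" "chart_inv d ` B = M \<inter> O'"
    by (auto simp: openin_open)
  have xB: "x \<in> chart_inv d ` B"
    by (rule image_eqI[of _ _ "snd d x"]) (use ch(1) x W e in \<open>auto simp: B_def\<close>)
  have const: "F y - F' y = k" if "y \<in> chart_inv d ` B" for y
    using that k by auto
  show ?thesis
    unfolding eventually_at_topological
  proof (intro exI[of _ O'] conjI ballI impI)
    show "open O'" "x \<in> O'"
      using O' xB by auto
    fix y assume "y \<in> O'" "y \<noteq> x" "y \<in> M"
    then have "y \<in> chart_inv d ` B"
      unfolding O'(2) by simp
    then show "F y - F' y = F x - F' x"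
      by (simp only: const xB)
  qed
qed

text \<open>The gluing takes place over the atlas \<open>A\<close>, with a disc around each point of each chart; the
  remaining coordinates see the result through \<open>body_form_change_chart\<close>.\<close>

lemma global_potential:
  assumes "simply_connected M"
  obtains \<epsilon> where "\<And>c m. c \<in> coords M A \<Longrightarrow> m \<in> cdom c \<Longrightarrow>
    ((\<epsilon> \<circ> chart_inv c) has_derivative body_form \<phi> c m) (at (snd c m))"
proof -
  have "\<forall>i\<in>Sigma A cdom. \<exists>WF. openin (top_of_set M) (fst WF) \<and> snd i \<in> fst WF \<and> fst WF \<subseteq> cdom (fst i) \<and>
      path_connected (fst WF) \<and>
      (\<forall>y\<in>fst WF. ((snd WF \<circ> chart_inv (fst i)) has_derivative body_form \<phi> (fst i) y) (at (snd (fst i) y)))"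
    using local_potential by fastforce
  then obtain WF where WF: "\<And>i. i \<in> Sigma A cdom \<Longrightarrow> openin (top_of_set M) (fst (WF i)) \<and>
      snd i \<in> fst (WF i) \<and> fst (WF i) \<subseteq> cdom (fst i) \<and> path_connected (fst (WF i)) \<and>
      (\<forall>y\<in>fst (WF i). ((snd (WF i) \<circ> chart_inv (fst i)) has_derivative body_form \<phi> (fst i) y) (at (snd (fst i) y)))"
    by metis
  define I where "I = Sigma A cdom"
  define W where "W i = fst (WF i)" for i
  define F where "F i = snd (WF i)" for i
  have props: "openin (top_of_set M) (W i)" "snd i \<in> W i" "W i \<subseteq> cdom (fst i)" "path_connected (W i)"
      "\<And>y. y \<in> W i \<Longrightarrow> ((F i \<circ> chart_inv (fst i)) has_derivative body_form \<phi> (fst i) y) (at (snd (fst i) y))"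
    if "i \<in> I" for i
    using WF[OF that[unfolded I_def]] by (auto simp: W_def F_def)
  have cover: "(\<Union>c\<in>A. cdom c) = M"
    using surface by (simp add: almost_complex_surface_def smooth_surface_def)
  interpret local_functions M I W F
  proof
    show "openin (top_of_set M) (W i)" if "i \<in> I" for i
      using props(1)[OF that] .
    show "(\<Union>i\<in>I. W i) = M"
    proof
      show "(\<Union>i\<in>I. W i) \<subseteq> M"
        using props(1) openin_imp_subset by blast
      show "M \<subseteq> (\<Union>i\<in>I. W i)"
        using cover props(2) by (force simp: I_def)
    qed
    show "\<forall>\<^sub>F y in at x within M. F i y - F j y = F i x - F j x"
      if "i \<in> I" "j \<in> I" "x \<in> W i" "x \<in> W j" for i j x
    proof -
      have A: "fst i \<in> A" "fst j \<in> A"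
        using that by (auto simp: I_def)
      show ?thesis
        by (rule potential_difference_locally_constant[OF A
              props(1)[OF that(1)] props(3)[OF that(1)] props(5)[OF that(1)]
              props(1)[OF that(2)] props(3)[OF that(2)] props(5)[OF that(2)] that(3,4)])
    qed
  qed
  obtain \<epsilon> where \<epsilon>: "\<And>i x y. i \<in> I \<Longrightarrow> x \<in> W i \<Longrightarrow> y \<in> W i \<Longrightarrow> \<epsilon> y - F i y = \<epsilon> x - F i x"
    using glue_simply_connected[OF assms props(4)] by metis
  have "((\<epsilon> \<circ> chart_inv c) has_derivative body_form \<phi> c m) (at (snd c m))"
    if c: "c \<in> coords M A" and m: "m \<in> cdom c" for c m
  proof -
    have "m \<in> M"
      using chart_inverse(4)[OF coords_chart[OF c] m] .
    then obtain d where d: "d \<in> A" "m \<in> cdom d"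
      using cover by blast
    have i: "(d, m) \<in> I"
      using d by (simp add: I_def)
    note ch = coords_chart[OF atlas_coords[OF d(1)]]
    have V: "open (snd d ` W (d, m))" "snd d m \<in> snd d ` W (d, m)"
      using props(1,2,3)[OF i] by (auto intro!: chart_image_open[OF ch])
    have "((\<epsilon> \<circ> chart_inv d) has_derivative body_form \<phi> d m) (at (snd d m))"
    proof (rule has_derivative_cong_open[OF V])
      show "((\<lambda>z. (F (d, m) \<circ> chart_inv d) z + (\<epsilon> m - F (d, m) m)) has_derivative body_form \<phi> d m) (at (snd d m))"
        using has_derivative_add[OF props(5)[OF i props(2)[OF i]] has_derivative_const] by simp
      fix z assume "z \<in> snd d ` W (d, m)"
      then obtain y where y: "y \<in> W (d, m)" "z = snd d y" by blast
      then have "chart_inv d z = y"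
        using chart_inverse(1)[OF ch] props(3)[OF i] by auto
      then show "(F (d, m) \<circ> chart_inv d) z + (\<epsilon> m - F (d, m) m) = (\<epsilon> \<circ> chart_inv d) z"
        using \<epsilon>[OF i _ y(1), of m] props(2)[OF i] by (simp add: algebra_simps)
    qed
    then show ?thesis
      by (rule body_form_change_chart[OF c d(1) m d(2)])
  qed
  then show ?thesis using that by blast
qed

end

section \<open>The associated surface of constant mean curvature\<close>

theorem theorem6p1:
  fixes M :: "'a::{t2_space,second_countable_topology} set"
    and A :: "'a chart set"
    and \<phi> :: "'a \<Rightarrow> quat \<times> quat"
  assumes "almost_complex_surface M A \<phi>"
    and "simply_connected M"
    and "\<forall>c\<in>coords M A. \<forall>m\<in>cdom c. \<forall>w. Lambda_dz2 c \<phi> m w = 0"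
  shows "\<exists>\<epsilon> :: 'a \<Rightarrow> real^3. immersion M A \<epsilon> \<and>
    (\<forall>c\<in>coords M A. isothermal c \<phi> \<longrightarrow>
       (\<forall>m\<in>cdom c. du c \<epsilon> m = alpha_tilde c \<phi> m \<and> dv c \<epsilon> m = beta_tilde c \<phi> m)) \<and>
    (\<forall>c\<in>coords M A. positively_oriented c \<phi> \<longrightarrow>
       (\<forall>m\<in>cdom c. mean_curvature c \<epsilon> m = - 2 / sqrt 3)) \<and>
    (\<forall>c\<in>coords M A. \<forall>m\<in>cdom c. \<forall>w w'.
       diff c \<epsilon> m w \<bullet> diff c \<epsilon> m w' = (1 / 2) * induced_metric c \<phi> m w w')"
proof -
  obtain \<epsilon> where \<epsilon>: "\<And>c m. c \<in> coords M A \<Longrightarrow> m \<in> cdom c \<Longrightarrow>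
    ((\<epsilon> \<circ> chart_inv c) has_derivative body_form \<phi> c m) (at (snd c m))"
    by (rule global_potential[OF assms(1,2)]) (rule that)
  \<comment> \<open>From here on \<open>d\<epsilon> = \<omega>\<close> in all coordinates, and each claim is a property of \<open>\<omega>\<close> in a patch.\<close>
  have diff_\<epsilon>: "diff c \<epsilon> m = body_form \<phi> c m" if "c \<in> coords M A" "m \<in> cdom c" for c m
    unfolding diff_def by (rule frechet_derivative_eqI[OF \<epsilon>[OF that]])
  have patch: "null_patch (snd c ` cdom c) (\<phi> \<circ> chart_inv c)" if c: "c \<in> coords M A" for c
  proof (intro null_patch.intro coords_patch[OF assms(1) c] null_patch_axioms.intro)
    fix z w assume "z \<in> snd c ` cdom c"
    then obtain m where m: "m \<in> cdom c" "z = snd c m" by blast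
    have "(\<phi> \<circ> chart_inv c) z = \<phi> m"
      using chart_inverse(1)[OF coords_chart[OF assms(1) c] m(1)] m(2) by simp
    then show "(let X = frechet_derivative (\<phi> \<circ> chart_inv c) (at z) w;
          Z = ((1/2) *\<^sub>R X, - ((1/2) *\<^sub>R nk_J ((\<phi> \<circ> chart_inv c) z) X))
        in gC ((\<phi> \<circ> chart_inv c) z) (PC ((\<phi> \<circ> chart_inv c) z) Z) Z) = 0"
      using assms(3) c m unfolding Lambda_dz2_def diff_def by auto
  qed
  show ?thesis
  proof (intro exI[of _ \<epsilon>] conjI ballI impI allI)
    show "immersion M A \<epsilon>"
      unfolding immersion_def smooth_map_def
    proof (intro conjI ballI)
      fix c assume c: "c \<in> coords M A"
      interpret null_patch "snd c ` cdom c" "\<phi> \<circ> chart_inv c"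
        by (rule patch[OF c])
      note \<omega> = patch_\<omega>[OF assms(1) c]
      show "smooth_on (\<epsilon> \<circ> chart_inv c) (snd c ` cdom c)"
      proof (rule smooth_onI_derivative[OF S _ smooth_\<omega>])
        fix z assume "z \<in> snd c ` cdom c"
        then obtain m where m: "m \<in> cdom c" "z = snd c m" by blast
        show "((\<epsilon> \<circ> chart_inv c) has_derivative \<omega> z) (at z)"
          using \<epsilon>[OF c m(1)] unfolding m(2) \<omega>[OF m(1)] .
      qed
      show "inj (diff c \<epsilon> m)" if "m \<in> cdom c" for m
        unfolding diff_\<epsilon>[OF c that] \<omega>[OF that, symmetric] by (rule inj_\<omega>) (use that in blast)
    qed
  next
    fix c m assume c: "c \<in> coords M A" and m: "m \<in> cdom c"
    interpret null_patch "snd c ` cdom c" "\<phi> \<circ> chart_inv c"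
      by (rule patch[OF c])
    have z: "snd c m \<in> snd c ` cdom c" using m by blast
    show "diff c \<epsilon> m w \<bullet> diff c \<epsilon> m w' = (1 / 2) * induced_metric c \<phi> m w w'" for w w'
      unfolding diff_\<epsilon>[OF c m] patch_\<omega>[OF assms(1) c m, symmetric] \<omega>_inner[OF z]
      by (simp add: induced_metric_def diff_def chart_inverse(1)[OF coords_chart[OF assms(1) c] m])
  next
    fix c m assume c: "c \<in> coords M A" and iso: "isothermal c \<phi>" and m: "m \<in> cdom c"
    interpret null_patch "snd c ` cdom c" "\<phi> \<circ> chart_inv c"
      by (rule patch[OF c])
    have z: "snd c m \<in> snd c ` cdom c" using m by blast
    have \<Phi>: "\<phi> (chart_inv c (snd c m)) = \<phi> m"
      using chart_inverse(1)[OF coords_chart[OF assms(1) c] m] by simp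
    have J: "nk_J ((\<phi> \<circ> chart_inv c) (snd c m)) (D (snd c m) 1) = D (snd c m) \<i>"
      using iso m by (simp add: isothermal_def diff_def \<Phi>)
    have ab: "alpha c \<phi> m = left_log p (snd c m) 1" "beta c \<phi> m = left_log p (snd c m) \<i>"
      by (simp_all add: alpha_def beta_def left_log_def diff_def \<Phi> comp_def)
    show "du c \<epsilon> m = alpha_tilde c \<phi> m" "dv c \<epsilon> m = beta_tilde c \<phi> m"
      unfolding diff_\<epsilon>[OF c m] patch_\<omega>[OF assms(1) c m, symmetric] \<omega>_isothermal[OF z J]
        alpha_tilde_def beta_tilde_def ab by (rule refl)+
  next
    fix c m assume c: "c \<in> coords M A" and pos: "positively_oriented c \<phi>" and m: "m \<in> cdom c"
    interpret null_patch "snd c ` cdom c" "\<phi> \<circ> chart_inv c"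
      by (rule patch[OF c])
    have z: "snd c m \<in> snd c ` cdom c" using m by blast
    have \<Phi>: "\<phi> (chart_inv c (snd c m)) = \<phi> m"
      using chart_inverse(1)[OF coords_chart[OF assms(1) c] m] by simp
    have first: "diff c \<epsilon> m = \<omega> (snd c m)"
      unfolding diff_\<epsilon>[OF c m] patch_\<omega>[OF assms(1) c m] ..
    have second: "diff c (\<lambda>x. diff c \<epsilon> x w) m = frechet_derivative (\<lambda>z. \<omega> z w) (at (snd c m))" for w
      unfolding diff_def[of c "\<lambda>x. diff c \<epsilon> x w"]
    proof (rule frechet_derivative_eqI, rule has_derivative_cong_open[OF S z _ \<omega>_derivative[OF z]])
      fix y assume "y \<in> snd c ` cdom c"
      then obtain x where x: "x \<in> cdom c" "y = snd c x" by blast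
      then show "\<omega> y w = ((\<lambda>x. diff c \<epsilon> x w) \<circ> chart_inv c) y"
        using chart_inverse(1)[OF coords_chart[OF assms(1) c] x(1)]
        by (simp add: diff_\<epsilon>[OF c x(1)] patch_\<omega>[OF assms(1) c x(1)])
    qed
    have "nk_g ((\<phi> \<circ> chart_inv c) (snd c m)) (nk_J ((\<phi> \<circ> chart_inv c) (snd c m)) (D (snd c m) 1)) (D (snd c m) \<i>) > 0"
      using pos m by (simp add: positively_oriented_def diff_def \<Phi>)
    from mean_curvature_\<omega>[OF z this]
    show "mean_curvature c \<epsilon> m = - 2 / sqrt 3"
      unfolding mean_curvature_def first_form_def second_form_def Let_def unit_normal_def second first .
  qed
qed

end
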